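(* There exists $n_0 \in \mathbb{N}$ such that the following holds for all integers $n \ge n_0$ that are divisible by $3$. Let $H$ be a $3$-uniform hypergraph on $n$ vertices with no isolated vertex. If $\sigma_2'(H) > \frac{2}{3}n^2 - \frac{8}{3}n + 2$, then $H$ contains a perfect matching.
   Context: A $3$-uniform hypergraph ($3$-graph) $H=(V,E)$ has edges that are $3$-element subsets of $V$. The degree $\deg(v)$ of a vertex $v$ is the number of edges containing $v$; a vertex is isolated if its degree is $0$. Two distinct vertices $u,v$ are adjacent if some edge of $H$ contains both. $\sigma_2'(H) = \min\{\deg(u)+\deg(v) : u, v \text{ adjacent in } H\}$. A perfect matching is a set of pairwise disjoint edges covering all vertices. (The value $\frac{2}{3}n^2 - \frac{8}{3}n + 2$ equals $\sigma_2'(H^* )$, where $H^*$ has vertex set partitioned into $S,T$ with $|S|=n/3+1$, $|T|=2n/3-1$, and edges all triples with at least two vertices in $T$.) *)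

theory Defs
  imports Complex_Main "HOL-Library.Disjoint_Sets"
begin

definition three_graph :: "'a set \<Rightarrow> 'a set set \<Rightarrow> bool" where
  "three_graph V E \<longleftrightarrow> finite V \<and> (\<forall>e\<in>E. e \<subseteq> V \<and> card e = 3)"

definition hdeg :: "'a set set \<Rightarrow> 'a \<Rightarrow> nat" where
  "hdeg E v = card {e \<in> E. v \<in> e}"

definition isolated_vertex :: "'a set set \<Rightarrow> 'a \<Rightarrow> bool" where
  "isolated_vertex E v \<longleftrightarrow> hdeg E v = 0"

definition adjacent :: "'a set set \<Rightarrow> 'a \<Rightarrow> 'a \<Rightarrow> bool" where
  "adjacent E u v \<longleftrightarrow> u \<noteq> v \<and> (\<exists>e\<in>E. u \<in> e \<and> v \<in> e)"

text \<open>The minimum is over a finite set when \<open>V\<close> is finite. That set is nonempty as soon as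
  \<open>E\<close> has an edge, hence whenever a nonempty 3-graph has no isolated vertex; for an edgeless
  3-graph the value is unspecified.\<close>

definition sigma2' :: "'a set \<Rightarrow> 'a set set \<Rightarrow> nat" where
  "sigma2' V E = Min {hdeg E u + hdeg E v | u v. u \<in> V \<and> v \<in> V \<and> adjacent E u v}"

definition perfect_matching :: "'a set \<Rightarrow> 'a set set \<Rightarrow> 'a set set \<Rightarrow> bool" where
  "perfect_matching V E M \<longleftrightarrow> M \<subseteq> E \<and> disjoint M \<and> \<Union>M = V"

end

theory Submission
  imports Defs
begin

text \<open>
  Write n for the number of vertices and D for half of the degree-sum bound. The vertices of degree
  at most D are pairwise non-adjacent. Saturate the hypergraph, without creating a perfect matching,
  by triples of vertices of degree above D and by triples consisting of one vertex w of degree at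
  most D and two neighbours of w; this preserves the degree-sum condition. If every such triple is
  present, a greedy choice of pairs of neighbours gives a perfect matching, and this is the only
  place where the exact bound matters. Otherwise a missing triple T is the complement of a matching
  M, and the three vertices of T have degree at least n^2/3 - O(n).

  For two edges e, f of M, the tripartite hypergraph between T, e and f has no perfect matching,
  hence at most 18 of 27 possible edges; if it has exactly 18, they are the triples avoiding one
  \<^emph>\<open>dead\<close> vertex. By the degrees of T, all but O(n) pairs (e,f) have a dead vertex. Every
  transversal of T, e, f through the dead vertex is again the complement of a matching that differs
  from M only near e and f, so the same structure holds for this new triple. Comparing the
  structures of a bounded number of such triples on a common pair of edges is contradictory.
\<close>

section \<open>Tripartite hypergraphs without perfect matching\<close>

text \<open>Double counting over perfect matchings gives the bound 18. Equality makes each of the 36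
  perfect matchings contain exactly two edges, and the only hypergraphs with this property arise by
  deleting one vertex.\<close>

lemma tripartite_dead_vertex:
  fixes P :: "'a \<Rightarrow> 'b \<Rightarrow> 'c \<Rightarrow> bool"
  assumes cards: "card A = 3" "card B = 3" "card C = 3"
    and nomatch: "\<And>x1 x2 x3 p1 p2 p3 q1 q2 q3. \<lbrakk>A = {x1,x2,x3}; B = {p1,p2,p3}; C = {q1,q2,q3}\<rbrakk> \<Longrightarrow>
        \<not> (P x1 p1 q1 \<and> P x2 p2 q2 \<and> P x3 p3 q3)"
  shows "(\<Sum>x\<in>A. \<Sum>p\<in>B. \<Sum>q\<in>C. of_bool (P x p q)) \<le> (18::nat)"
    and "(\<Sum>x\<in>A. \<Sum>p\<in>B. \<Sum>q\<in>C. of_bool (P x p q)) = (18::nat) \<Longrightarrow>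
      (\<exists>a\<in>A. \<forall>x\<in>A. \<forall>p\<in>B. \<forall>q\<in>C. P x p q \<longleftrightarrow> x \<noteq> a) \<or>
      (\<exists>b\<in>B. \<forall>x\<in>A. \<forall>p\<in>B. \<forall>q\<in>C. P x p q \<longleftrightarrow> p \<noteq> b) \<or>
      (\<exists>c\<in>C. \<forall>x\<in>A. \<forall>p\<in>B. \<forall>q\<in>C. P x p q \<longleftrightarrow> q \<noteq> c)"
proof -
  obtain x1 x2 x3 where A: "A = {x1,x2,x3}" "x1 \<noteq> x2" "x1 \<noteq> x3" "x2 \<noteq> x3"
    using cards(1) by (auto simp: card_3_iff)
  obtain p1 p2 p3 where B: "B = {p1,p2,p3}" "p1 \<noteq> p2" "p1 \<noteq> p3" "p2 \<noteq> p3"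
    using cards(2) by (auto simp: card_3_iff)
  obtain q1 q2 q3 where C: "C = {q1,q2,q3}" "q1 \<noteq> q2" "q1 \<noteq> q3" "q2 \<noteq> q3"
    using cards(3) by (auto simp: card_3_iff)
  define S where "S p q = (of_bool (P x1 (fst p) (fst q)) + of_bool (P x2 (fst (snd p)) (fst (snd q)))
      + of_bool (P x3 (snd (snd p)) (snd (snd q))) :: nat)" for p q
  let ?PB = "{(p1,p2,p3),(p1,p3,p2),(p2,p1,p3),(p2,p3,p1),(p3,p1,p2),(p3,p2,p1)}"
  let ?PC = "{(q1,q2,q3),(q1,q3,q2),(q2,q1,q3),(q2,q3,q1),(q3,q1,q2),(q3,q2,q1)}"
  have S: "S p q \<le> 2" if "p \<in> ?PB" "q \<in> ?PC" for p q
  proof -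
    have "B = {fst p, fst (snd p), snd (snd p)}" "C = {fst q, fst (snd q), snd (snd q)}"
      using that B(1) C(1) by auto
    from nomatch[OF A(1) this] show ?thesis by (auto simp: S_def)
  qed
  \<comment> \<open>The 36 perfect matchings of the complete tripartite hypergraph fall into four families of nine,
    each of which partitions the 27 triples; every matching misses at least one edge.\<close>
  let ?s = "\<Sum>x\<in>A. \<Sum>p\<in>B. \<Sum>q\<in>C. of_bool (P x p q) :: nat"
  let ?B1 = "{(p1,p2,p3),(p2,p3,p1),(p3,p1,p2)}" and ?B2 = "{(p1,p3,p2),(p2,p1,p3),(p3,p2,p1)}"
  let ?C1 = "{(q1,q2,q3),(q2,q3,q1),(q3,q1,q2)}" and ?C2 = "{(q1,q3,q2),(q2,q1,q3),(q3,q2,q1)}"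
  have eq: "?s = (\<Sum>p\<in>B'. \<Sum>q\<in>C'. S p q)" if "B' \<in> {?B1,?B2}" "C' \<in> {?C1,?C2}" for B' C'
    using that A B C by (auto simp: S_def)
  have le: "S p q \<le> 2" if "p \<in> B'" "q \<in> C'" "B' \<in> {?B1,?B2}" "C' \<in> {?C1,?C2}" for p q B' C'
    by (rule S) (use that in auto)
  have cc: "card B' = 3" "card C' = 3" if "B' \<in> {?B1,?B2}" "C' \<in> {?C1,?C2}" for B' C'
    using that B C by auto
  have bnd: "(\<Sum>p\<in>B'. \<Sum>q\<in>C'. S p q) \<le> (\<Sum>p\<in>B'. \<Sum>q\<in>C'. 2)" if "B' \<in> {?B1,?B2}" "C' \<in> {?C1,?C2}" for B' C'
    by (intro sum_mono le) (use that in auto)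
  have e18: "(\<Sum>p\<in>B'. \<Sum>q\<in>C'. 2) = (18::nat)" if "B' \<in> {?B1,?B2}" "C' \<in> {?C1,?C2}" for B' C'
    using cc[OF that] by simp
  show "?s \<le> 18" using eq[of ?B1 ?C1] bnd[of ?B1 ?C1] e18[of ?B1 ?C1] by simp
  assume s18: "?s = 18"
  have S2': "S p q = 2" if pq: "p \<in> B'" "q \<in> C'" and BC: "B' \<in> {?B1,?B2}" "C' \<in> {?C1,?C2}" for p q B' C'
  proof (rule ccontr)
    assume "S p q \<noteq> 2"
    hence lt: "S p q < 2" using le[OF pq BC] by simp
    have fin: "finite B'" "finite C'" using BC by auto
    have "(\<Sum>q\<in>C'. S p q) < (\<Sum>q\<in>C'. 2)"
      using lt fin pq le[OF _ _ BC] by (intro sum_strict_mono_ex1) auto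
    moreover have "(\<Sum>q\<in>C'. S p' q) \<le> (\<Sum>q\<in>C'. 2)" if "p' \<in> B'" for p'
      using that le[OF _ _ BC] by (intro sum_mono) auto
    ultimately have "(\<Sum>p\<in>B'. \<Sum>q\<in>C'. S p q) < (\<Sum>p\<in>B'. \<Sum>q\<in>C'. 2)"
      using fin pq by (intro sum_strict_mono_ex1) auto
    thus False using eq[OF BC] e18[OF BC] s18 by simp
  qed
  have S2: "S p q = 2" if p: "p \<in> ?PB" and q: "q \<in> ?PC" for p q
  proof -
    have "p \<in> ?B1 \<or> p \<in> ?B2" "q \<in> ?C1 \<or> q \<in> ?C2" using p q by auto
    thus ?thesis using S2'[of p _ q] by (meson insertI1 insertI2)
  qed
  have b2: "of_bool a + of_bool b + of_bool c = (2::nat) \<longleftrightarrow> (a \<and> b \<and> \<not> c) \<or> (a \<and> \<not> b \<and> c) \<or> (\<not> a \<and> b \<and> c)"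
    for a b c by auto
  have "\<forall>p\<in>?PB. \<forall>q\<in>?PC. S p q = 2" using S2 by blast
  \<comment> \<open>"Exactly two of three" is put in clause form: what remains is propositional in
    the 27 atoms \<open>P x p q\<close> and is decided by \<open>sat\<close>.\<close>
  hence F: "\<forall>p\<in>?PB. \<forall>q\<in>?PC. let a = P x1 (fst p) (fst q); b = P x2 (fst (snd p)) (fst (snd q));
      c = P x3 (snd (snd p)) (snd (snd q)) in (a \<or> b) \<and> (a \<or> c) \<and> (b \<or> c) \<and> (\<not> a \<or> \<not> b \<or> \<not> c)"
    unfolding S_def b2 Let_def by blast
  show "(\<exists>a\<in>A. \<forall>x\<in>A. \<forall>p\<in>B. \<forall>q\<in>C. P x p q \<longleftrightarrow> x \<noteq> a) \<or>
      (\<exists>b\<in>B. \<forall>x\<in>A. \<forall>p\<in>B. \<forall>q\<in>C. P x p q \<longleftrightarrow> p \<noteq> b) \<or>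
      (\<exists>c\<in>C. \<forall>x\<in>A. \<forall>p\<in>B. \<forall>q\<in>C. P x p q \<longleftrightarrow> q \<noteq> c)"
    using F A(2-4) A(2-4)[symmetric] B(2-4) B(2-4)[symmetric] C(2-4) C(2-4)[symmetric]
    unfolding A(1) B(1) C(1) Let_def
    apply (simp del: not_all not_ex de_Morgan_conj de_Morgan_disj)
    by sat
qed
section \<open>Counting\<close>

text \<open>Pigeonhole over rows. It serves to fix one matching edge that forms suitable pairs with
  a positive proportion of the others.\<close>

lemma card_gt_vertical_section:
  assumes "finite S" "R \<subseteq> S \<times> S" "c * card S < card R"
  shows "\<exists>x\<in>S. c < card (R `` {x})"
proof (rule ccontr)
  assume "\<not> ?thesis"
  hence le: "card (R `` {x}) \<le> c" if "x \<in> S" for x using that by force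
  have fin: "finite (R `` {x})" for x
    by (rule finite_subset[OF _ assms(1)]) (use assms(2) in auto)
  have "R = Sigma S (\<lambda>x. R `` {x})" using assms(2) by auto
  hence "card R = (\<Sum>x\<in>S. card (R `` {x}))" using card_SigmaI[OF assms(1), of "\<lambda>x. R `` {x}"] fin by simp
  also have "\<dots> \<le> (\<Sum>x\<in>S. c)" by (intro sum_mono le)
  finally show False using assms(3) by (simp add: mult.commute)
qed

text \<open>Union bound: each of the three conditions fails for at most
  \<open>c * (card N)^2\<close> of the \<open>(card N)^3\<close> triples.\<close>

lemma exists_triple_avoiding:
  fixes B :: "'a \<Rightarrow> ('a \<times> 'a) set"
  assumes fin: "finite N" and B: "\<And>f. f \<in> N \<Longrightarrow> B f \<subseteq> N \<times> N" "\<And>f. f \<in> N \<Longrightarrow> card (B f) \<le> c * card N"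
    and c: "3 * c < card N"
  obtains f g h where "f \<in> N" "g \<in> N" "h \<in> N" "(g,h) \<notin> B f" "(f,h) \<notin> B g" "(f,g) \<notin> B h"
proof -
  let ?n = "card N"
  define S where "S = Sigma N B"
  \<comment> \<open>\<open>S\<close> holds the violations indexed by the first coordinate; the two
    images hold those indexed by the second and the third.\<close>
  let ?S2 = "(\<lambda>(g,f,h). (f,g,h)) ` S" and ?S3 = "(\<lambda>(h,f,g). (f,g,h)) ` S"
  have finB: "finite (B f)" if "f \<in> N" for f using B(1)[OF that] fin finite_subset by blast
  have finS: "finite S" unfolding S_def using fin finB by (intro finite_SigmaI)
  have "card S = (\<Sum>f\<in>N. card (B f))" unfolding S_def using finB by (intro card_SigmaI fin) auto
  also have "\<dots> \<le> (\<Sum>f\<in>N. c * ?n)" by (intro sum_mono B(2))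
  finally have S: "card S \<le> c * (?n * ?n)" by (simp add: mult.commute mult.left_commute)
  have "card (S \<union> ?S2 \<union> ?S3) \<le> card S + card S + card S"
    using card_Un_le[of "S \<union> ?S2" ?S3] card_Un_le[of S ?S2]
      card_image_le[OF finS, of "\<lambda>(g,f,h). (f,g,h)"] card_image_le[OF finS, of "\<lambda>(h,f,g). (f,g,h)"] by linarith
  also have "\<dots> \<le> (3 * c) * (?n * ?n)" using S by simp
  also have "\<dots> < ?n * (?n * ?n)" using c by (intro mult_strict_right_mono) auto
  also have "\<dots> = card (N \<times> N \<times> N)" by (simp add: card_cartesian_product)
  finally have "\<not> N \<times> N \<times> N \<subseteq> S \<union> ?S2 \<union> ?S3"
    using card_mono[of "S \<union> ?S2 \<union> ?S3" "N \<times> N \<times> N"] finS by auto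
  then obtain f g h where fgh: "f \<in> N" "g \<in> N" "h \<in> N" "(f,g,h) \<notin> S \<union> ?S2 \<union> ?S3" by auto
  have "(g,h) \<notin> B f" "(f,h) \<notin> B g" "(f,g) \<notin> B h"
    using fgh unfolding S_def image_def by force+
  thus ?thesis using fgh that by blast
qed

section \<open>Leftover triples and dead vertices\<close>

lemma perfect_matching_Un:
  assumes "perfect_matching A E M" "perfect_matching B E N" "A \<inter> B = {}"
  shows "perfect_matching (A \<union> B) E (M \<union> N)"
  using assms unfolding perfect_matching_def by (auto intro!: disjoint_union)

lemma perfect_matching_Diff:
  assumes "perfect_matching A E M" "N \<subseteq> M"
  shows "perfect_matching (A - \<Union>N) E (M - N)"
proof -
  have "disjoint (M - N)"
    using assms unfolding perfect_matching_def disjoint_def by blast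
  moreover have "\<Union>(M - N) = A - \<Union>N"
  proof -
    have "e \<inter> f = {}" if "e \<in> M - N" "f \<in> N" for e f
      by (rule disjointD[of M]) (use that assms in \<open>auto simp: perfect_matching_def\<close>)
    hence "\<Union>(M - N) \<inter> \<Union>N = {}" by auto
    moreover have "\<Union>(M - N) \<union> \<Union>N = A"
      using assms by (auto simp: perfect_matching_def)
    ultimately show ?thesis by auto
  qed
  ultimately show ?thesis
    using assms unfolding perfect_matching_def by blast
qed

lemma perfect_matching_single: "e \<in> E \<Longrightarrow> perfect_matching e E {e}"
  by (simp add: perfect_matching_def)

lemma card_eq_double_sum:
  assumes "finite S" "R \<subseteq> S \<times> S"
  shows "card R = (\<Sum>x\<in>S. \<Sum>y\<in>S. of_bool ((x,y) \<in> R))"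
proof -
  have "(\<Sum>x\<in>S. \<Sum>y\<in>S. of_bool ((x,y) \<in> R)) = (\<Sum>w\<in>S \<times> S. of_bool (w \<in> R) :: nat)"
    by (simp add: sum.cartesian_product case_prod_beta)
  also have "\<dots> = card (S \<times> S \<inter> R)"
    using assms(1) by (simp add: sum.If_cases of_bool_def)
  finally show ?thesis using assms(2) by (simp add: Int_absorb1)
qed

lemma card_3_elem:
  assumes "card A = 3" "a \<in> A"
  obtains y z where "A = {a,y,z}" "a \<noteq> y" "a \<noteq> z" "y \<noteq> z"
proof -
  have "card (A - {a}) = 2" using assms by simp
  then obtain y z where "A - {a} = {y,z}" "y \<noteq> z" unfolding card_2_iff by blast
  with assms that[of y z] show ?thesis by (metis Diff_iff insertCI insert_Diff)
qed

definition leftover :: "'a set \<Rightarrow> 'a set set \<Rightarrow> 'a set \<Rightarrow> 'a set set \<Rightarrow> bool" where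
  "leftover V E T M \<longleftrightarrow> T \<subseteq> V \<and> card T = 3 \<and> perfect_matching (V - T) E M"

text \<open>The equality case of \<open>tripartite_dead_vertex\<close>, with the three possible
  positions of the deleted vertex merged into one condition.\<close>

definition dead_vertex :: "'a set set \<Rightarrow> 'a set \<Rightarrow> 'a set \<Rightarrow> 'a set \<Rightarrow> 'a \<Rightarrow> bool" where
  "dead_vertex E T e f v \<longleftrightarrow>
     v \<in> T \<union> e \<union> f \<and> (\<forall>x\<in>T. \<forall>p\<in>e. \<forall>q\<in>f. {x,p,q} \<in> E \<longleftrightarrow> v \<notin> {x,p,q})"

text \<open>Pairs are ordered, in accordance with the double sums over \<open>M\<close> that count
  degrees; the diagonal is estimated separately there.\<close>

definition undead_pairs :: "'a set set \<Rightarrow> 'a set \<Rightarrow> 'a set set \<Rightarrow> ('a set \<times> 'a set) set" where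
  "undead_pairs E T M = {(e,f). e \<in> M \<and> f \<in> M \<and> e \<noteq> f \<and> (\<nexists>v. dead_vertex E T e f v)}"

section \<open>Augmentation, exchange and degrees along a leftover matching\<close>

locale no_matching_graph =
  fixes V :: "'a set" and E :: "'a set set"
  assumes graph: "three_graph V E"
    and no_matching: "\<not> perfect_matching V E M"
begin

lemma fin_V: "finite V" and edgeD: "e \<in> E \<Longrightarrow> e \<subseteq> V \<and> card e = 3"
  using graph by (auto simp: three_graph_def)

lemma edge_finite: "e \<in> E \<Longrightarrow> finite e"
  using edgeD card.infinite by fastforce

lemma fin_E: "finite E"
  by (rule finite_subset[of _ "Pow V"]) (use edgeD fin_V in auto)

lemma edge_distinct: "{x,p,q} \<in> E \<Longrightarrow> x \<noteq> p \<and> x \<noteq> q \<and> p \<noteq> q"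
  using edgeD[of "{x,p,q}"] by (auto simp: card_insert_if split: if_splits)

lemma leftoverD:
  assumes "leftover V E T M"
  shows "finite M" "finite T" "T \<subseteq> V" "card T = 3" "\<Union>M = V - T" "M \<subseteq> E"
    and "e \<in> M \<Longrightarrow> card e = 3" "e \<in> M \<Longrightarrow> finite e" "e \<in> M \<Longrightarrow> e \<subseteq> V" "e \<in> M \<Longrightarrow> e \<inter> T = {}"
    and "\<lbrakk>e \<in> M; f \<in> M; e \<noteq> f\<rbrakk> \<Longrightarrow> e \<inter> f = {}"
proof -
  have M: "M \<subseteq> E" "disjoint M" "\<Union>M = V - T" "T \<subseteq> V" "card T = 3"
    using assms by (auto simp: leftover_def perfect_matching_def)
  show "finite M" "finite T" "T \<subseteq> V" "card T = 3" "\<Union>M = V - T" "M \<subseteq> E"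
    using M fin_E fin_V finite_subset by blast+
  show "e \<in> M \<Longrightarrow> card e = 3" "e \<in> M \<Longrightarrow> finite e" "e \<in> M \<Longrightarrow> e \<subseteq> V" "e \<in> M \<Longrightarrow> e \<inter> T = {}"
    using M edgeD edge_finite by blast+
  show "\<lbrakk>e \<in> M; f \<in> M; e \<noteq> f\<rbrakk> \<Longrightarrow> e \<inter> f = {}"
    using M(2) by (auto simp: disjoint_def)
qed

lemma card_leftover:
  assumes "leftover V E T M"
  shows "card V = 3 * card M + 3"
proof -
  note L = leftoverD[OF assms]
  have "card (\<Union>M) = (\<Sum>e\<in>M. card e)"
    using L(8,11) by (intro card_Union_disjoint) (auto simp: pairwise_def disjnt_def)
  also have "\<dots> = (\<Sum>e\<in>M. 3)" by (rule sum.cong) (use L(7) in auto)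
  finally have "card (V - T) = 3 * card M" using L(5) by simp
  thus ?thesis using card_Diff_subset[of T V] L(2,3,4) card_mono[OF fin_V L(3)] by simp
qed

text \<open>Three such edges would be pairwise disjoint, and putting them in place of
  \<open>e\<close> and \<open>f\<close> would turn \<open>M\<close> into a perfect matching of
  \<open>V\<close>.\<close>

lemma no_augmentation:
  assumes L: "leftover V E T M" and ef: "e \<in> M" "f \<in> M" "e \<noteq> f"
    and eq: "T = {x1,x2,x3}" "e = {p1,p2,p3}" "f = {q1,q2,q3}"
  shows "\<not> ({x1,p1,q1} \<in> E \<and> {x2,p2,q2} \<in> E \<and> {x3,p3,q3} \<in> E)"
proof
  assume *: "{x1,p1,q1} \<in> E \<and> {x2,p2,q2} \<in> E \<and> {x3,p3,q3} \<in> E"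
  note L' = leftoverD[OF L]
  have d: "x1 \<noteq> x2" "x1 \<noteq> x3" "x2 \<noteq> x3" "p1 \<noteq> p2" "p1 \<noteq> p3" "p2 \<noteq> p3" "q1 \<noteq> q2" "q1 \<noteq> q3" "q2 \<noteq> q3"
    using L'(4) L'(7)[OF ef(1)] L'(7)[OF ef(2)] unfolding eq
    by (auto simp: card_insert_if split: if_splits)
  have dis: "e \<inter> T = {}" "f \<inter> T = {}" "e \<inter> f = {}"
    using L'(10,11) ef by auto
  have 1: "perfect_matching (V - T - \<Union>{e,f}) E (M - {e,f})"
    using L ef unfolding leftover_def by (intro perfect_matching_Diff) auto
  have 2: "perfect_matching ({x1,p1,q1} \<union> {x2,p2,q2} \<union> {x3,p3,q3}) E ({{x1,p1,q1}} \<union> {{x2,p2,q2}} \<union> {{x3,p3,q3}})"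
    using * d dis unfolding eq by (intro perfect_matching_Un perfect_matching_single) auto
  have "perfect_matching ((V - T - \<Union>{e,f}) \<union> ({x1,p1,q1} \<union> {x2,p2,q2} \<union> {x3,p3,q3})) E
     ((M - {e,f}) \<union> ({{x1,p1,q1}} \<union> {{x2,p2,q2}} \<union> {{x3,p3,q3}}))"
    by (rule perfect_matching_Un[OF 1 2]) (auto simp: eq)
  moreover have "(V - T - \<Union>{e,f}) \<union> ({x1,p1,q1} \<union> {x2,p2,q2} \<union> {x3,p3,q3}) = V"
    using L'(3) L'(9)[OF ef(1)] L'(9)[OF ef(2)] unfolding eq by auto
  ultimately show False using no_matching by metis
qed

text \<open>The triple \<open>{x,p,q}\<close> takes up the dead vertex, so two disjoint transversals
  of the remaining six vertices are edges. They replace \<open>e\<close> and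
  \<open>f\<close>.\<close>

lemma exchange:
  assumes L: "leftover V E T M" and ef: "e \<in> M" "f \<in> M" "e \<noteq> f"
    and dead: "dead_vertex E T e f v" and xpq: "x \<in> T" "p \<in> e" "q \<in> f" "v \<in> {x,p,q}"
  obtains M' where "leftover V E {x,p,q} M'" "M - {e,f} \<subseteq> M'"
proof -
  note L' = leftoverD[OF L]
  obtain x2 x3 where T: "T = {x,x2,x3}" "x \<noteq> x2" "x \<noteq> x3" "x2 \<noteq> x3" using card_3_elem[OF L'(4) xpq(1)] .
  obtain p2 p3 where e: "e = {p,p2,p3}" "p \<noteq> p2" "p \<noteq> p3" "p2 \<noteq> p3" using card_3_elem[OF L'(7)[OF ef(1)] xpq(2)] .
  obtain q2 q3 where f: "f = {q,q2,q3}" "q \<noteq> q2" "q \<noteq> q3" "q2 \<noteq> q3" using card_3_elem[OF L'(7)[OF ef(2)] xpq(3)] .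
  have dis: "e \<inter> T = {}" "f \<inter> T = {}" "e \<inter> f = {}"
    using L'(10,11) ef by auto
  have "v \<notin> {x2,p2,q2}" "v \<notin> {x3,p3,q3}" using xpq(4) dis T e f by auto
  hence "{x2,p2,q2} \<in> E" "{x3,p3,q3} \<in> E"
    using dead T(1) e(1) f(1) unfolding dead_vertex_def by blast+
  hence 2: "perfect_matching ({x2,p2,q2} \<union> {x3,p3,q3}) E ({{x2,p2,q2}} \<union> {{x3,p3,q3}})"
    using dis T e f by (intro perfect_matching_Un perfect_matching_single) auto
  have 1: "perfect_matching (V - T - \<Union>{e,f}) E (M - {e,f})"
    using L ef unfolding leftover_def by (intro perfect_matching_Diff) auto
  have "perfect_matching ((V - T - \<Union>{e,f}) \<union> ({x2,p2,q2} \<union> {x3,p3,q3})) E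
     ((M - {e,f}) \<union> ({{x2,p2,q2}} \<union> {{x3,p3,q3}}))" (is "perfect_matching _ E ?M'")
    by (rule perfect_matching_Un[OF 1 2]) (auto simp: T e f)
  moreover have "(V - T - \<Union>{e,f}) \<union> ({x2,p2,q2} \<union> {x3,p3,q3}) = V - {x,p,q}"
    using L'(3) L'(9)[OF ef(1)] L'(9)[OF ef(2)] dis T e f by auto
  moreover have "{x,p,q} \<subseteq> V" "card {x,p,q} = 3"
    using L'(3) L'(9)[OF ef(1)] L'(9)[OF ef(2)] dis T(1) e(1) f(1) by (auto simp: card_insert_if)
  ultimately have "leftover V E {x,p,q} ?M'" by (simp add: leftover_def)
  thus ?thesis by (rule that) auto
qed

text \<open>The value 18 is reached only with a dead vertex. The \<open>of_bool\<close> term records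
  the loss of at least one edge on each undead pair.\<close>

lemma link_sum_le:
  assumes L: "leftover V E T M" and ef: "e \<in> M" "f \<in> M" "e \<noteq> f"
  shows "(\<Sum>x\<in>T. \<Sum>p\<in>e. \<Sum>q\<in>f. of_bool ({x,p,q} \<in> E)) + of_bool ((e,f) \<in> undead_pairs E T M) \<le> (18::nat)"
proof -
  note L' = leftoverD[OF L]
  let ?s = "\<Sum>x\<in>T. \<Sum>p\<in>e. \<Sum>q\<in>f. of_bool ({x,p,q} \<in> E) :: nat"
  note cards = L'(4) L'(7)[OF ef(1)] L'(7)[OF ef(2)]
  have aug: "\<not> ({x1,p1,q1} \<in> E \<and> {x2,p2,q2} \<in> E \<and> {x3,p3,q3} \<in> E)"
    if "T = {x1,x2,x3}" "e = {p1,p2,p3}" "f = {q1,q2,q3}" for x1 x2 x3 p1 p2 p3 q1 q2 q3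
    by (rule no_augmentation[OF L ef that])
  note tri = tripartite_dead_vertex[of T e f "\<lambda>x p q. {x,p,q} \<in> E", OF cards aug, simplified]
  have dis: "e \<inter> T = {}" "f \<inter> T = {}" "e \<inter> f = {}"
    using L'(10,11) ef by auto
  have "(e,f) \<notin> undead_pairs E T M" if "?s = 18"
  proof -
    from tri(2)[OF that] have "\<exists>v. dead_vertex E T e f v"
    proof (elim disjE bexE)
      fix a assume "a \<in> T" "\<forall>x\<in>T. \<forall>p\<in>e. \<forall>q\<in>f. ({x,p,q} \<in> E) = (x \<noteq> a)"
      hence "dead_vertex E T e f a" using dis unfolding dead_vertex_def by auto
      thus ?thesis ..
    next
      fix a assume "a \<in> e" "\<forall>x\<in>T. \<forall>p\<in>e. \<forall>q\<in>f. ({x,p,q} \<in> E) = (p \<noteq> a)"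
      hence "dead_vertex E T e f a" using dis unfolding dead_vertex_def by auto
      thus ?thesis ..
    next
      fix a assume "a \<in> f" "\<forall>x\<in>T. \<forall>p\<in>e. \<forall>q\<in>f. ({x,p,q} \<in> E) = (q \<noteq> a)"
      hence "dead_vertex E T e f a" using dis unfolding dead_vertex_def by auto
      thus ?thesis ..
    qed
    thus ?thesis by (simp add: undead_pairs_def)
  qed
  thus ?thesis using tri(1) by (cases "?s = 18") auto
qed

text \<open>Each edge at \<open>x\<close> is counted for both orders of its other two vertices;
  repeated entries never give an edge.\<close>

lemma hdeg_eq_sum:
  assumes "x \<in> V"
  shows "2 * hdeg E x = (\<Sum>p\<in>V. \<Sum>q\<in>V. of_bool ({x,p,q} \<in> E))"
proof -
  let ?P = "{(p,q). p \<in> V \<and> q \<in> V \<and> {x,p,q} \<in> E}"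
  let ?F = "\<lambda>e. {(p,q). {x,p,q} = e}"
  have cF: "card (?F e) = 2 \<and> finite (?F e)" if e': "e \<in> {e \<in> E. x \<in> e}" for e
  proof -
    have "card e = 3" "x \<in> e" using e' edgeD by auto
    then obtain y z where e: "e = {x,y,z}" "x \<noteq> y" "x \<noteq> z" "y \<noteq> z"
      by (rule card_3_elem)
    have "(p,q) \<in> {(y,z),(z,y)}" if eq: "{x,p,q} = e" for p q
    proof -
      have "y \<in> {x,p,q}" "z \<in> {x,p,q}" using eq e(1) by auto
      thus ?thesis using e by auto
    qed
    hence "?F e = {(y,z),(z,y)}" using e(1) by auto
    thus ?thesis using e by simp
  qed
  have "?P = (\<Union>e\<in>{e \<in> E. x \<in> e}. ?F e)" using edgeD by auto
  also have "card \<dots> = (\<Sum>e\<in>{e \<in> E. x \<in> e}. card (?F e))"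
    using cF fin_E by (intro card_UN_disjoint) auto
  also have "\<dots> = (\<Sum>e\<in>{e \<in> E. x \<in> e}. 2)" by (rule sum.cong) (use cF in auto)
  finally have "card ?P = 2 * hdeg E x" by (simp add: hdeg_def)
  moreover have "card ?P = (\<Sum>p\<in>V. \<Sum>q\<in>V. of_bool ({x,p,q} \<in> E))"
    by (subst card_eq_double_sum[OF fin_V]) auto
  ultimately show ?thesis by simp
qed

text \<open>Ordered pairs with an entry in \<open>T\<close> number at most
  \<open>6 * card V\<close>; the others are sorted by the matching edges containing their
  entries.\<close>

lemma hdeg_le_matching_sum:
  assumes L: "leftover V E T M" and x: "x \<in> V"
  shows "2 * hdeg E x \<le> 6 * card V + (\<Sum>e\<in>M. \<Sum>f\<in>M. \<Sum>p\<in>e. \<Sum>q\<in>f. of_bool ({x,p,q} \<in> E))"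
proof -
  note L' = leftoverD[OF L]
  let ?g = "\<lambda>p q. of_bool ({x,p,q} \<in> E) :: nat"
  have V: "V = T \<union> \<Union>M" "T \<inter> \<Union>M = {}" using L'(3,5) by auto
  have fM: "finite (\<Union>M)" using L'(5) fin_V by auto
  have UM: "(\<Sum>p\<in>\<Union>M. h p) = (\<Sum>e\<in>M. \<Sum>p\<in>e. h p)" for h :: "'a \<Rightarrow> nat"
    using L'(8,11) by (subst sum.Union_disjoint) auto
  have sp: "(\<Sum>p\<in>V. h p) = (\<Sum>p\<in>T. h p) + (\<Sum>p\<in>\<Union>M. h p)" for h :: "'a \<Rightarrow> nat"
    unfolding V(1) using V(2) L'(2) fM by (rule_tac sum.union_disjoint) auto
  have b: "(\<Sum>q\<in>A. ?g p q) \<le> card A" for A p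
    using sum_bounded_above[of A "?g p" 1] by simp
  have "2 * hdeg E x = (\<Sum>p\<in>T. \<Sum>q\<in>V. ?g p q) + (\<Sum>p\<in>\<Union>M. \<Sum>q\<in>V. ?g p q)"
    unfolding hdeg_eq_sum[OF x] sp[of "\<lambda>p. \<Sum>q\<in>V. ?g p q"] ..
  also have "(\<Sum>p\<in>\<Union>M. \<Sum>q\<in>V. ?g p q) = (\<Sum>p\<in>\<Union>M. \<Sum>q\<in>T. ?g p q) + (\<Sum>p\<in>\<Union>M. \<Sum>q\<in>\<Union>M. ?g p q)"
    by (simp add: sp sum.distrib)
  also have "(\<Sum>p\<in>\<Union>M. \<Sum>q\<in>\<Union>M. ?g p q) = (\<Sum>e\<in>M. \<Sum>f\<in>M. \<Sum>p\<in>e. \<Sum>q\<in>f. ?g p q)"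
    unfolding UM by (intro sum.cong refl) (rule sum.swap)
  also have "(\<Sum>p\<in>T. \<Sum>q\<in>V. ?g p q) \<le> 3 * card V"
    using sum_mono[of T "\<lambda>p. \<Sum>q\<in>V. ?g p q" "\<lambda>p. card V"] b L'(4) by simp
  also have "(\<Sum>p\<in>\<Union>M. \<Sum>q\<in>T. ?g p q) \<le> 3 * card V"
  proof -
    have "(\<Sum>p\<in>\<Union>M. \<Sum>q\<in>T. ?g p q) \<le> (\<Sum>p\<in>\<Union>M. card T)" by (intro sum_mono b)
    also have "\<dots> \<le> 3 * card V" using card_mono[OF fin_V, of "\<Union>M"] L'(4,5) by simp
    finally show ?thesis .
  qed
  finally show ?thesis by simp
qed

text \<open>Each of about \<open>n^2/9\<close> ordered pairs of matching edges contributes at most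
  18, and each undead pair at most 17.\<close>

lemma degree_sum_bound:
  assumes L: "leftover V E T M"
  shows "2 * (\<Sum>x\<in>T. hdeg E x) + card (undead_pairs E T M) \<le> 2 * (card V)\<^sup>2 + 9 * card V + 9"
proof -
  note L' = leftoverD[OF L]
  let ?B = "undead_pairs E T M"
  let ?s = "\<lambda>e f. \<Sum>x\<in>T. \<Sum>p\<in>e. \<Sum>q\<in>f. of_bool ({x,p,q} \<in> E) :: nat"
  let ?b = "\<lambda>e f. of_bool ((e,f) \<in> ?B) :: nat"
  have cB: "card ?B = (\<Sum>e\<in>M. \<Sum>f\<in>M. ?b e f)"
    by (rule card_eq_double_sum[OF L'(1)]) (auto simp: undead_pairs_def)
  have swap: "(\<Sum>x\<in>T. \<Sum>e\<in>M. \<Sum>f\<in>M. G x e f) = (\<Sum>e\<in>M. \<Sum>f\<in>M. \<Sum>x\<in>T. G x e f)"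
    for G :: "'a \<Rightarrow> 'a set \<Rightarrow> 'a set \<Rightarrow> nat"
    by (subst sum.swap) (rule sum.cong[OF refl sum.swap])
  have "(\<Sum>x\<in>T. 2 * hdeg E x) \<le> (\<Sum>x\<in>T. 6 * card V + (\<Sum>e\<in>M. \<Sum>f\<in>M. \<Sum>p\<in>e. \<Sum>q\<in>f. of_bool ({x,p,q} \<in> E)))"
    by (intro sum_mono hdeg_le_matching_sum[OF L]) (use L'(3) in auto)
  also have "\<dots> = 18 * card V + (\<Sum>e\<in>M. \<Sum>f\<in>M. ?s e f)"
    using L'(4) swap by (simp add: sum.distrib)
  finally have 1: "2 * (\<Sum>x\<in>T. hdeg E x) + card ?B \<le> 18 * card V + (\<Sum>e\<in>M. \<Sum>f\<in>M. ?s e f + ?b e f)"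
    unfolding cB by (simp add: sum.distrib sum_distrib_left)
  \<comment> \<open>A diagonal pair may contribute up to 27, hence the extra 9.\<close>
  have "?s e f + ?b e f \<le> 18 + 9 * of_bool (e = f)" if "e \<in> M" "f \<in> M" for e f
  proof (cases "e = f")
    case True
    have "?s e f \<le> (\<Sum>x\<in>T. \<Sum>p\<in>e. \<Sum>q\<in>f. 1)" by (intro sum_mono) auto
    also have "\<dots> = 27" using L'(4) L'(7)[OF that(1)] L'(7)[OF that(2)] by simp
    finally show ?thesis using True by (simp add: undead_pairs_def)
  qed (use link_sum_le[OF L that] in auto)
  hence "(\<Sum>e\<in>M. \<Sum>f\<in>M. ?s e f + ?b e f) \<le> (\<Sum>e\<in>M. \<Sum>f\<in>M. 18 + 9 * of_bool (e = f))"
    by (intro sum_mono) auto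
  also have "\<dots> = 18 * (card M)\<^sup>2 + 9 * card M"
    using L'(1) by (simp add: sum.distrib of_bool_def power2_eq_square algebra_simps flip: sum_distrib_left)
  \<comment> \<open>With \<open>m = card M\<close>, the bound obtained and the bound claimed both
    equal \<open>18*m^2 + 63*m + 54\<close>.\<close>
  finally show ?thesis using 1 unfolding card_leftover[OF L] by (simp add: power2_eq_square algebra_simps)
qed

text \<open>The constant 110 is above the 40 of \<open>deg_T\<close>, so vertices of
  \<open>T\<close> are not low, and above 95 + 8, so by \<open>deg_T_upper\<close> and
  \<open>deg_sum\<close> no vertex of \<open>T\<close> is adjacent to a low one.\<close>

definition low :: "'a \<Rightarrow> bool" where
  "low v \<longleftrightarrow> 3 * hdeg E v + 110 * card V < (card V)\<^sup>2"

lemma undead_pairs_subset: "undead_pairs E T M \<subseteq> M \<times> M"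
  by (auto simp: undead_pairs_def)

lemma finite_undead_pairs: "finite M \<Longrightarrow> finite (undead_pairs E T M)"
  by (rule finite_subset[OF undead_pairs_subset]) auto

text \<open>Three degrees close to \<open>n^2/3\<close> nearly exhaust
  \<open>degree_sum_bound\<close> and leave at most \<open>229 * n + 9\<close> for the undead
  pairs.\<close>

lemma card_undead_pairs_le:
  assumes L: "leftover V E T M" and nl: "\<And>x. x \<in> T \<Longrightarrow> \<not> low x" and n: "9 \<le> card V"
  shows "card (undead_pairs E T M) \<le> 230 * card V"
proof -
  have "(\<Sum>x\<in>T. (card V)\<^sup>2) \<le> (\<Sum>x\<in>T. 3 * hdeg E x + 110 * card V)"
    by (intro sum_mono) (use nl in \<open>auto simp: low_def not_less\<close>)
  hence "3 * (card V)\<^sup>2 \<le> 3 * (\<Sum>x\<in>T. hdeg E x) + 330 * card V"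
    using leftoverD(4)[OF L] by (simp add: sum.distrib sum_distrib_left)
  thus ?thesis using degree_sum_bound[OF L] n by linarith
qed

text \<open>The restriction to \<open>M - {e,f}\<close> keeps to edges of the original matching,
  whichever two edges the exchange puts in.\<close>

lemma card_undead_pairs_exchange_le:
  assumes L: "leftover V E T M" and ef: "e \<in> M" "f \<in> M" "e \<noteq> f"
    and dead: "dead_vertex E T e f v" and xpq: "x \<in> T" "p \<in> e" "q \<in> f" "v \<in> {x,p,q}"
    and nl: "\<not> low x" "\<not> low p" "\<not> low q" and n: "9 \<le> card V"
  shows "card (undead_pairs E {x,p,q} (M - {e,f})) \<le> 230 * card V"
proof -
  obtain M' where M': "leftover V E {x,p,q} M'" "M - {e,f} \<subseteq> M'"
    by (rule exchange[OF L ef dead xpq])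
  have fin: "finite (undead_pairs E {x,p,q} M')"
    by (rule finite_undead_pairs[OF leftoverD(1)[OF M'(1)]])
  have "card (undead_pairs E {x,p,q} (M - {e,f})) \<le> card (undead_pairs E {x,p,q} M')"
    by (rule card_mono[OF fin]) (use M'(2) in \<open>auto simp: undead_pairs_def\<close>)
  also have "\<dots> \<le> 230 * card V"
    by (rule card_undead_pairs_le[OF M'(1) _ n]) (use nl in auto)
  finally show ?thesis .
qed

end

section \<open>Hypergraphs with a leftover triple of large degree\<close>

lemma dead_vertex_commute:
  assumes d: "dead_vertex E T e f v"
  shows "dead_vertex E T f e v"
  unfolding dead_vertex_def
proof (intro conjI ballI)
  show "v \<in> T \<union> f \<union> e" using d by (auto simp: dead_vertex_def)
  fix x p q assume "x \<in> T" "p \<in> f" "q \<in> e"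
  moreover have "{x,p,q} = {x,q,p}" by auto
  ultimately show "({x,p,q} \<in> E) = (v \<notin> {x,p,q})" using d unfolding dead_vertex_def by metis
qed

section \<open>Links of a vertex between two matching edges\<close>

definition full_link :: "'a set set \<Rightarrow> 'a set \<Rightarrow> 'a set \<Rightarrow> 'a \<Rightarrow> bool" where
  "full_link E g h x \<longleftrightarrow> (\<forall>p\<in>g. \<forall>q\<in>h. {x,p,q} \<in> E)"

definition empty_link :: "'a set set \<Rightarrow> 'a set \<Rightarrow> 'a set \<Rightarrow> 'a \<Rightarrow> bool" where
  "empty_link E g h x \<longleftrightarrow> (\<forall>p\<in>g. \<forall>q\<in>h. {x,p,q} \<notin> E)"

lemma not_full_and_empty: "\<lbrakk>g \<noteq> {}; h \<noteq> {}; full_link E g h x\<rbrakk> \<Longrightarrow> \<not> empty_link E g h x"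
  by (auto simp: full_link_def empty_link_def)

lemma dead_vertex_in_T:
  assumes "dead_vertex E T g h v" "v \<in> T" "g \<inter> T = {}" "h \<inter> T = {}"
  shows "empty_link E g h v" and "\<lbrakk>x \<in> T; x \<noteq> v\<rbrakk> \<Longrightarrow> full_link E g h x"
  using assms unfolding dead_vertex_def empty_link_def full_link_def by auto

lemma card_3_avoid:
  assumes "card A = 3" obtains a where "a \<in> A" "a \<noteq> v"
  using assms by (auto simp: card_3_iff)

text \<open>If \<open>v\<close> differed from \<open>x\<close>, some transversal through
  \<open>x\<close> would avoid \<open>v\<close> and be an edge.\<close>

lemma dead_vertex_if_empty_link:
  assumes dead: "dead_vertex E T g h v" and "x \<in> T" "empty_link E g h x" "card g = 3" "card h = 3"
  shows "v = x"
proof (rule ccontr)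
  assume "v \<noteq> x"
  obtain p q where "p \<in> g" "p \<noteq> v" "q \<in> h" "q \<noteq> v" using assms card_3_avoid by metis
  thus False using assms \<open>v \<noteq> x\<close> unfolding dead_vertex_def empty_link_def by auto
qed

text \<open>Every vertex of \<open>g\<close> and \<open>h\<close> lies in an edge with
  \<open>x\<close>, so neither these vertices nor \<open>x\<close> can be dead.\<close>

lemma dead_vertex_if_full_link:
  assumes dead: "dead_vertex E T g h v" and "x \<in> T" "full_link E g h x" "card g = 3" "card h = 3"
  shows "v \<in> T \<and> v \<noteq> x"
proof -
  obtain p q where "p \<in> g" "q \<in> h" using assms card_3_avoid by metis
  thus ?thesis using assms unfolding dead_vertex_def full_link_def by auto
qed

text \<open>An empty or full link at \<open>x\<close> forces the dead vertex into the triple. Then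
  exactly one vertex of the triple has an empty link, and the other two have full links.\<close>

lemma triple_links:
  assumes dead: "dead_vertex E {x,a,y} g h v" and gh: "card g = 3" "card h = 3"
    and dis: "g \<inter> {x,a,y} = {}" "h \<inter> {x,a,y} = {}" and "x \<noteq> a" "x \<noteq> y" "a \<noteq> y"
  shows "empty_link E g h x \<Longrightarrow> full_link E g h a \<and> full_link E g h y"
    and "full_link E g h x \<Longrightarrow>
      empty_link E g h a \<and> full_link E g h y \<or> full_link E g h a \<and> empty_link E g h y"
proof -
  assume "empty_link E g h x"
  hence "v = x" using dead_vertex_if_empty_link[OF dead] gh by simp
  thus "full_link E g h a \<and> full_link E g h y"
    using dead_vertex_in_T(2)[OF dead _ dis] assms(6-8) by auto
next
  assume "full_link E g h x"
  hence "v = a \<or> v = y" using dead_vertex_if_full_link[OF dead] gh by auto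
  thus "empty_link E g h a \<and> full_link E g h y \<or> full_link E g h a \<and> empty_link E g h y"
    using dead_vertex_in_T[OF dead _ dis] assms(6-8) by auto
qed

text \<open>By the first description no triple through \<open>d1\<close> is an edge. If
  \<open>d1\<close> lies in \<open>g\<close>, the second description provides an edge through it; if
  it lies in \<open>h\<close>, the third does.\<close>

lemma inconsistent_slices:
  assumes cards: "card f = 3" "card g = 3" "card h = 3"
    and 1: "d1 \<in> g \<union> h" "\<And>p r s. \<lbrakk>p \<in> f; r \<in> g; s \<in> h\<rbrakk> \<Longrightarrow> {p,r,s} \<in> E \<longleftrightarrow> d1 \<noteq> r \<and> d1 \<noteq> s"
    and 2: "\<And>p r s. \<lbrakk>p \<in> f; r \<in> g; s \<in> h\<rbrakk> \<Longrightarrow> {p,r,s} \<in> E \<longleftrightarrow> d2 \<noteq> p \<and> d2 \<noteq> s"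
    and 3: "\<And>p r s. \<lbrakk>p \<in> f; r \<in> g; s \<in> h\<rbrakk> \<Longrightarrow> {p,r,s} \<in> E \<longleftrightarrow> d3 \<noteq> p \<and> d3 \<noteq> r"
  shows False
  using 1(1)
proof
  assume d: "d1 \<in> g"
  obtain p s where "p \<in> f" "p \<noteq> d2" "s \<in> h" "s \<noteq> d2" using cards card_3_avoid by metis
  thus False using 1(2)[OF _ d] 2[OF _ d] by metis
next
  assume d: "d1 \<in> h"
  obtain p r where "p \<in> f" "p \<noteq> d3" "r \<in> g" "r \<noteq> d3" using cards card_3_avoid by metis
  thus False using 1(2)[OF _ _ d] 3[OF _ _ d] by metis
qed

text \<open>\<open>deg_sum\<close> is the hypothesis on \<open>sigma2'\<close> multiplied by three
  and rearranged so that no subtraction occurs.\<close>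

locale near_matching = no_matching_graph V E for V :: "'a set" and E +
  fixes T :: "'a set" and M :: "'a set set"
  assumes L: "leftover V E T M"
    and big: "100000000 \<le> card V"
    and deg_T: "x \<in> T \<Longrightarrow> (card V)\<^sup>2 \<le> 3 * hdeg E x + 40 * card V"
    and deg_sum: "adjacent E u v \<Longrightarrow> 2 * (card V)\<^sup>2 + 6 < 3 * (hdeg E u + hdeg E v) + 8 * card V"
begin

abbreviation "n \<equiv> card V"
abbreviation "U \<equiv> undead_pairs E T M"

definition M0 :: "'a set set" where "M0 = {e \<in> M. \<forall>v\<in>e. \<not> low v}"

definition A :: "'a \<Rightarrow> ('a set \<times> 'a set) set" where
  "A x = {(e,f). e \<in> M \<and> f \<in> M \<and> e \<noteq> f \<and> dead_vertex E T e f x}"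

lemmas LD = leftoverD[OF L]

lemma fin_M0: "finite M0" and M0_M: "M0 \<subseteq> M"
  using LD(1) by (auto simp: M0_def)

lemma n_M: "n = 3 * card M + 3" by (rule card_leftover[OF L])

lemma fin_U: "finite U"
  by (rule finite_undead_pairs[OF LD(1)])

lemma A_subset: "A x \<subseteq> M \<times> M" by (auto simp: A_def)

lemma fin_A: "finite (A x)"
  using A_subset LD(1) finite_subset by blast

lemma T_not_low: "x \<in> T \<Longrightarrow> \<not> low x"
  using deg_T[of x] big by (auto simp: low_def)

lemma M0_not_low: "\<lbrakk>e \<in> M0; p \<in> e\<rbrakk> \<Longrightarrow> \<not> low p"
  by (auto simp: M0_def)

lemma card_U: "card U \<le> 230 * n"
  by (rule card_undead_pairs_le[OF L T_not_low]) (use big in auto)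

text \<open>The lower bounds \<open>deg_T\<close> for the other two vertices are subtracted from
  \<open>degree_sum_bound\<close>.\<close>

lemma deg_T_upper:
  assumes x: "x \<in> T" shows "3 * hdeg E x \<le> n\<^sup>2 + 95 * n"
proof -
  obtain y z where T: "T = {x,y,z}" "x \<noteq> y" "x \<noteq> z" "y \<noteq> z" using card_3_elem[OF LD(4) x] .
  have "2 * hdeg E x + 2 * hdeg E y + 2 * hdeg E z \<le> 2 * n\<^sup>2 + 9 * n + 9"
    using degree_sum_bound[OF L] T by simp
  moreover have "n\<^sup>2 \<le> 3 * hdeg E y + 40 * n" "n\<^sup>2 \<le> 3 * hdeg E z + 40 * n" using deg_T T by auto
  ultimately show ?thesis using big by linarith
qed

lemma T_not_adjacent_low:
  assumes "x \<in> T" "low v" shows "{x,v,q} \<notin> E"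
proof
  assume e: "{x,v,q} \<in> E"
  hence "adjacent E x v" using edge_distinct[OF e] by (auto simp: adjacent_def)
  thus False using deg_sum[of x v] deg_T_upper[OF assms(1)] assms(2) unfolding low_def by fastforce
qed

text \<open>No edge joins a low vertex to \<open>T\<close>. If both edges of a pair contain low
  vertices, a dead vertex would have to equal one of them in each edge. So all pairs of distinct
  edges outside \<open>M0\<close> are undead, and there are only linearly many undead pairs.\<close>

lemma card_low_edges: "50 * card (M - M0) \<le> n"
proof (rule ccontr)
  assume *: "\<not> ?thesis"
  let ?K = "M - M0"
  have "(e,f) \<in> U" if ef: "e \<in> ?K" "f \<in> ?K" "e \<noteq> f" for e f
  proof -
    have "\<not> dead_vertex E T e f v" for v
    proof
      assume dead: "dead_vertex E T e f v"
      obtain a b where ab: "a \<in> e" "low a" "b \<in> f" "low b" using ef by (auto simp: M0_def)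
      have c: "card e = 3" "card f = 3" "e \<inter> f = {}" using LD(7,11) ef by auto
      obtain x where x: "x \<in> T" "x \<noteq> v" using card_3_avoid LD(4) by metis
      obtain p where p: "p \<in> e" "p \<noteq> v" using card_3_avoid c by metis
      obtain q where q: "q \<in> f" "q \<noteq> v" using card_3_avoid c by metis
      have "{x,a,q} \<notin> E" "{x,b,p} \<notin> E" using T_not_adjacent_low x ab by auto
      moreover have "{x,b,p} = {x,p,b}" by auto
      ultimately have "{x,a,q} \<notin> E" "{x,p,b} \<notin> E" by auto
      hence "v = a" "v = b" using dead x p q ab unfolding dead_vertex_def by auto
      thus False using ab c by auto
    qed
    thus ?thesis using ef by (auto simp: undead_pairs_def)
  qed
  hence "?K \<times> ?K \<subseteq> (\<lambda>e. (e,e)) ` ?K \<union> U" by auto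
  hence "card (?K \<times> ?K) \<le> card ((\<lambda>e. (e,e)) ` ?K \<union> U)"
    using LD(1) fin_U by (intro card_mono) auto
  also have "\<dots> \<le> card ?K + 230 * n"
    using card_Un_le[of "(\<lambda>e. (e,e)) ` ?K" U] card_U card_image_le[of ?K "\<lambda>e. (e,e)"] LD(1) by simp
  finally have "card ?K * card ?K \<le> card ?K + 230 * n" by (simp add: card_cartesian_product)
  \<comment> \<open>The negated claim gives \<open>n < 50 * card ?K\<close>, and
    \<open>230 * 50 + 1 = 11501\<close>.\<close>
  hence "card ?K * card ?K \<le> 11501 * card ?K" using * by linarith
  hence "card ?K \<le> 11501" unfolding mult_le_cancel2 using * by linarith
  thus False using * big by linarith
qed

lemma card_M0: "n \<le> 4 * card M0"
proof -
  have "card M = card M0 + card (M - M0)"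
    using card_Diff_subset[OF fin_M0 M0_M] card_mono[OF LD(1) M0_M] by simp
  thus ?thesis using card_low_edges n_M big by linarith
qed

text \<open>On a pair where x is dead, the triple \<open>{x,a,y}\<close> forces a and y to have full links, whereas
  \<open>{x',a,y}\<close> forces one of them to have an empty link.\<close>

lemma small_A_if_dead_pair:
  assumes hk: "h \<in> M0" "k \<in> M0" "h \<noteq> k" and a: "a \<in> h" "dead_vertex E T h k a" and x: "x \<in> T"
  shows "card (A x) \<le> 470 * n"
proof -
  have hkM: "h \<in> M" "k \<in> M" using hk M0_M by auto
  obtain x' where x': "x' \<in> T" "x' \<noteq> x" using card_3_avoid LD(4) by metis
  obtain y where y: "y \<in> k" using card_3_avoid LD(7)[OF hkM(2)] by metis
  have nl: "\<not> low a" "\<not> low y" using M0_not_low hk a y by auto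
  let ?U1 = "undead_pairs E {x,a,y} (M - {h,k})" and ?U2 = "undead_pairs E {x',a,y} (M - {h,k})"
  \<comment> \<open>Pairs that use \<open>h\<close> or \<open>k\<close> are given up, as both
    exchanges remove these edges from the matching.\<close>
  let ?X = "{h,k} \<times> M \<union> M \<times> {h,k}"
  \<comment> \<open>Both triples contain the dead vertex \<open>a\<close>, so
    \<open>exchange\<close> leaves the vertices in \<open>T\<close> and in \<open>k\<close>
    arbitrary.\<close>
  have U12: "card ?U1 \<le> 230 * n" "card ?U2 \<le> 230 * n"
    using card_undead_pairs_exchange_le[OF L hkM hk(3) a(2) _ a(1) y] T_not_low x x' nl big by auto
  have hT: "h \<inter> T = {}" "k \<inter> T = {}" "h \<inter> k = {}" using LD(10,11) hkM hk(3) by auto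
  hence ne: "x \<noteq> a" "x \<noteq> y" "a \<noteq> y" "x' \<noteq> a" "x' \<noteq> y" using a y x x' by auto
  have "A x \<subseteq> ?U1 \<union> ?U2 \<union> ?X"
  proof (rule subrelI, rule ccontr)
    fix e f assume "(e,f) \<in> A x" "(e,f) \<notin> ?U1 \<union> ?U2 \<union> ?X"
    hence nU1: "(e,f) \<notin> ?U1" and nU2: "(e,f) \<notin> ?U2"
      and ef: "e \<in> M - {h,k}" "f \<in> M - {h,k}" "e \<noteq> f" and dead: "dead_vertex E T e f x" by (auto simp: A_def)
    have dis: "e \<inter> {x,a,y} = {}" "f \<inter> {x,a,y} = {}" "e \<inter> {x',a,y} = {}" "f \<inter> {x',a,y} = {}"
      using LD(10)[of e] LD(10)[of f] LD(11)[of e h] LD(11)[of f h] LD(11)[of e k] LD(11)[of f k] ef hkM a y x x' by auto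
    have c: "card e = 3" "card f = 3" using LD(7) ef by auto
    have eT: "e \<inter> T = {}" "f \<inter> T = {}" using LD(10) ef by auto
    obtain v1 where v1: "dead_vertex E {x,a,y} e f v1" using nU1 ef by (auto simp: undead_pairs_def)
    obtain v2 where v2: "dead_vertex E {x',a,y} e f v2" using nU2 ef by (auto simp: undead_pairs_def)
    have "empty_link E e f x" "full_link E e f x'" using dead_vertex_in_T[OF dead x eT] x' by auto
    moreover have "e \<noteq> {}" "f \<noteq> {}" using c by auto
    ultimately show False using triple_links(1)[OF v1 c dis(1,2) ne(1,2,3)]
        triple_links(2)[OF v2 c dis(3,4) ne(4,5,3)] not_full_and_empty[of e f E] by blast
  qed
  moreover have "finite (?U1 \<union> ?U2 \<union> ?X)"
    using LD(1) by (auto intro: finite_undead_pairs)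
  ultimately have "card (A x) \<le> card (?U1 \<union> ?U2 \<union> ?X)" by (rule card_mono[rotated])
  also have "\<dots> \<le> card ?U1 + card ?U2 + (card ({h,k} \<times> M) + card (M \<times> {h,k}))"
    using card_Un_le[of "?U1 \<union> ?U2" ?X] card_Un_le[of ?U1 ?U2] card_Un_le[of "{h,k} \<times> M" "M \<times> {h,k}"] by linarith
  also have "\<dots> \<le> 460 * n + 4 * card M" using U12 hk(3) by (simp add: card_cartesian_product)
  also have "\<dots> \<le> 470 * n" using n_M by linarith
  finally show ?thesis .
qed

text \<open>Otherwise the degree of \<open>c\<close> would be at most
  \<open>9 * n^2 / 50 + 3 * n\<close>, which is below the bound of \<open>deg_T\<close>.\<close>

lemma exists_linked_pair:
  assumes c: "c \<in> T" and Y: "Y \<subseteq> M \<times> M" "25 * card Y \<le> n\<^sup>2"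
  shows "\<exists>h\<in>M. \<exists>k\<in>M. (h,k) \<notin> Y \<and> (\<exists>p\<in>h. \<exists>q\<in>k. {c,p,q} \<in> E)"
proof (rule ccontr)
  assume "\<not> ?thesis"
  hence none: "{c,p,q} \<notin> E" if "h \<in> M" "k \<in> M" "(h,k) \<notin> Y" "p \<in> h" "q \<in> k" for h k p q
    using that by blast
  have le: "(\<Sum>p\<in>h. \<Sum>q\<in>k. of_bool ({c,p,q} \<in> E)) \<le> 9 * (of_bool ((h,k) \<in> Y) :: nat)"
    if "h \<in> M" "k \<in> M" for h k
  proof (cases "(h,k) \<in> Y")
    case True
    have "(\<Sum>p\<in>h. \<Sum>q\<in>k. of_bool ({c,p,q} \<in> E)) \<le> (\<Sum>p\<in>h. \<Sum>q\<in>k. 1 :: nat)"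
      by (intro sum_mono) auto
    thus ?thesis using LD(7)[OF that(1)] LD(7)[OF that(2)] True by simp
  next
    case False
    thus ?thesis using none[OF that False] by simp
  qed
  have "2 * hdeg E c \<le> 6 * n + (\<Sum>h\<in>M. \<Sum>k\<in>M. \<Sum>p\<in>h. \<Sum>q\<in>k. of_bool ({c,p,q} \<in> E))"
    by (rule hdeg_le_matching_sum[OF L]) (use c LD(3) in auto)
  also have "\<dots> \<le> 6 * n + (\<Sum>h\<in>M. \<Sum>k\<in>M. 9 * of_bool ((h,k) \<in> Y))"
    by (intro add_left_mono sum_mono le)
  also have "\<dots> = 6 * n + 9 * card Y"
    by (simp add: card_eq_double_sum[OF LD(1) Y(1)] sum_distrib_left)
  finally have "2 * hdeg E c \<le> 6 * n + 9 * card Y" .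
  hence "23 * n\<^sup>2 \<le> 2450 * n" using Y(2) deg_T[OF c] by linarith
  thus False using big by (simp add: power2_eq_square)
qed

text \<open>Otherwise all dead vertices lie in T, and every leftover triple splits into one vertex with
  empty link and two with full links on a typical pair. The three overlapping triples
  \<open>{x,p0,p}\<close>, \<open>{x,p0,q}\<close>, \<open>{c,p,q}\<close> cannot all do so.\<close>

lemma exists_dead_pair_in_M0:
  shows "\<exists>h\<in>M0. \<exists>k\<in>M0. h \<noteq> k \<and> (\<exists>a\<in>h. dead_vertex E T h k a)"
proof (rule ccontr)
  assume none: "\<not> ?thesis"
  have in_T: "v \<in> T" if "h \<in> M0" "k \<in> M0" "h \<noteq> k" "dead_vertex E T h k v" for h k v
  proof -
    have "v \<in> T \<union> h \<union> k" using that(4) by (simp add: dead_vertex_def)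
    moreover have "v \<notin> h" using none that by auto
    moreover have "v \<notin> k" using none that dead_vertex_commute[OF that(4)] by auto
    ultimately show ?thesis by auto
  qed
  let ?m = "card M0"
  \<comment> \<open>\<open>G\<close> misses only linearly many pairs of \<open>M0\<close>, and on
    each of its pairs the dead vertex lies in \<open>T\<close>.\<close>
  define G where "G = {(e,f). e \<in> M0 \<and> f \<in> M0 \<and> e \<noteq> f \<and> (e,f) \<notin> U}"
  have G: "(e,f) \<in> G \<longleftrightarrow> e \<in> M0 \<and> f \<in> M0 \<and> e \<noteq> f \<and> (e,f) \<notin> U" for e f by (simp add: G_def)
  let ?D = "(\<lambda>e. (e,e)) ` M0"
  have finG: "finite G" by (rule finite_subset[of _ "M0 \<times> M0"]) (use fin_M0 G in auto)
  have m: "25000000 \<le> ?m" using card_M0 big by linarith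
  have U: "card U \<le> 920 * ?m" using card_U card_M0 by linarith
  have cD: "card ?D \<le> ?m" using fin_M0 by (rule card_image_le)
  have "M0 \<times> M0 \<subseteq> ?D \<union> U \<union> G" using G by auto
  hence "card (M0 \<times> M0) \<le> card (?D \<union> U \<union> G)"
    using fin_M0 fin_U finG by (intro card_mono) auto
  also have "\<dots> \<le> card ?D + card U + card G"
    using card_Un_le[of "?D \<union> U" G] card_Un_le[of ?D U] by linarith
  finally have cG: "?m * ?m \<le> 921 * ?m + card G"
    using U cD by (simp add: card_cartesian_product)
  have "\<exists>x\<in>T. card G \<le> 3 * card (G \<inter> A x)"
  proof (rule ccontr)
    assume "\<not> ?thesis"
    hence lt: "3 * card (G \<inter> A x) < card G" if "x \<in> T" for x using that by force
    have "G \<subseteq> (\<Union>x\<in>T. G \<inter> A x)"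
    proof (rule subrelI)
      fix e f assume ef: "(e,f) \<in> G"
      then obtain v where v: "dead_vertex E T e f v" using M0_M by (auto simp: G undead_pairs_def)
      hence "v \<in> T" using in_T ef G by blast
      moreover have "(e,f) \<in> A v" using v ef M0_M by (auto simp: G A_def)
      ultimately show "(e,f) \<in> (\<Union>x\<in>T. G \<inter> A x)" using ef by blast
    qed
    hence "card G \<le> card (\<Union>x\<in>T. G \<inter> A x)" using LD(2) finG by (intro card_mono) auto
    also have "\<dots> \<le> (\<Sum>x\<in>T. card (G \<inter> A x))" using LD(2) by (rule card_UN_le)
    finally have "3 * card G \<le> (\<Sum>x\<in>T. 3 * card (G \<inter> A x))" by (simp flip: sum_distrib_left)
    also have "\<dots> < (\<Sum>x\<in>T. card G)"
      using lt LD(2,4) by (intro sum_strict_mono) auto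
    finally show False using LD(4) by simp
  qed
  then obtain x where x: "x \<in> T" "card G \<le> 3 * card (G \<inter> A x)" by blast
  \<comment> \<open>Some \<open>x\<close> in \<open>T\<close> is dead on a third of
    \<open>G\<close>, that is on at least \<open>(?m^2 - 921 * ?m) / 3\<close> pairs; this exceeds a
    tenth of \<open>?m^2\<close>.\<close>
  let ?c = "?m div 10"
  have "10 * (?c * ?m) \<le> ?m * ?m" using mult_right_mono[of "10 * ?c" ?m ?m] by simp
  moreover have "25000000 * ?m \<le> ?m * ?m" using m by (intro mult_right_mono) auto
  ultimately have "?c * ?m < card (G \<inter> A x)" using x(2) cG m by linarith
  moreover have "G \<inter> A x \<subseteq> M0 \<times> M0" using G by auto
  ultimately obtain e0 where e0: "e0 \<in> M0" "?c < card ((G \<inter> A x) `` {e0})"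
    using card_gt_vertical_section[OF fin_M0] by metis
  let ?N = "(G \<inter> A x) `` {e0}"
  have NM: "?N \<subseteq> M0" using G by auto
  have finN: "finite ?N" using finite_subset[OF NM fin_M0] .
  have N10: "?m \<le> 10 * card ?N" using e0(2) by linarith
  \<comment> \<open>Two partners of \<open>e0\<close> are needed that have a dead vertex between
    themselves; otherwise \<open>?N \<times> ?N\<close> would lie in the diagonal and
    \<open>U\<close>, which together have only linear size.\<close>
  have "\<exists>e f. e \<in> ?N \<and> f \<in> ?N \<and> e \<noteq> f \<and> (e,f) \<notin> U"
  proof (rule ccontr)
    assume "\<not> ?thesis"
    hence "?N \<times> ?N \<subseteq> (\<lambda>e. (e,e)) ` ?N \<union> U" by blast
    hence "card (?N \<times> ?N) \<le> card ((\<lambda>e. (e,e)) ` ?N \<union> U)"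
      using finN fin_U by (intro card_mono) auto
    also have "\<dots> \<le> card ?N + card U"
      using card_Un_le[of "(\<lambda>e. (e,e)) ` ?N" U] card_image_le[OF finN, of "\<lambda>e. (e,e)"] by linarith
    finally have "card ?N * card ?N \<le> card ?N + card U" by (simp add: card_cartesian_product)
    hence "card ?N * card ?N \<le> 9201 * card ?N" using U N10 by linarith
    hence "card ?N \<le> 9201" unfolding mult_le_cancel2 using N10 m by linarith
    thus False using N10 m by linarith
  qed
  then obtain e f where ef: "e \<in> ?N" "f \<in> ?N" "e \<noteq> f" "(e,f) \<notin> U" by blast
  hence M0s: "e0 \<in> M0" "e \<in> M0" "f \<in> M0" "e0 \<noteq> e" "e0 \<noteq> f"
    and dead: "dead_vertex E T e0 e x" "dead_vertex E T e0 f x" by (auto simp: A_def G)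
  have Ms: "e0 \<in> M" "e \<in> M" "f \<in> M" using M0s M0_M by auto
  obtain c where deadc: "dead_vertex E T e f c" using ef Ms by (auto simp: undead_pairs_def)
  have c: "c \<in> T" by (rule in_T[OF M0s(2,3) ef(3) deadc])
  obtain p0 where p0: "p0 \<in> e0" using card_3_avoid LD(7)[OF Ms(1)] by metis
  obtain p where p: "p \<in> e" using card_3_avoid LD(7)[OF Ms(2)] by metis
  obtain q where q: "q \<in> f" using card_3_avoid LD(7)[OF Ms(3)] by metis
  have nl: "\<not> low x" "\<not> low c" "\<not> low p0" "\<not> low p" "\<not> low q"
    using T_not_low x(1) c M0_not_low M0s p0 p q by auto
  have n9: "9 \<le> n" using big by simp
  let ?U1 = "undead_pairs E {x,p0,p} (M - {e0,e})"
  let ?U2 = "undead_pairs E {x,p0,q} (M - {e0,f})"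
  let ?U3 = "undead_pairs E {c,p,q} (M - {e,f})"
  have U1: "card ?U1 \<le> 230 * n"
    by (rule card_undead_pairs_exchange_le[OF L Ms(1,2) M0s(4) dead(1) x(1) p0 p _ nl(1,3,4) n9]) simp
  have U2: "card ?U2 \<le> 230 * n"
    by (rule card_undead_pairs_exchange_le[OF L Ms(1,3) M0s(5) dead(2) x(1) p0 q _ nl(1,3,5) n9]) simp
  have U3: "card ?U3 \<le> 230 * n"
    by (rule card_undead_pairs_exchange_le[OF L Ms(2,3) ef(3) deadc c p q _ nl(2,4,5) n9]) simp
  let ?DM = "(\<lambda>e. (e,e)) ` M"
  let ?K = "M - M0"
  let ?S = "{e0,e,f}"
  \<comment> \<open>These are the pairs on which one of the four triples may lack a dead vertex, or
    which meet \<open>M - M0\<close>. Only the last kind can be quadratic;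
    \<open>card_low_edges\<close> limits its share of \<open>25 * card ?Y\<close> to
    \<open>card M * n\<close>.\<close>
  let ?Y = "?DM \<union> U \<union> ?U1 \<union> ?U2 \<union> ?U3 \<union> ?S \<times> M \<union> M \<times> ?S \<union> ?K \<times> M \<union> M \<times> ?K"
  have YM: "?Y \<subseteq> M \<times> M"
    using Ms undead_pairs_subset by (auto simp: undead_pairs_def)
  have S3: "card ?S \<le> 3" by (simp add: card_insert_if)
  have "card ?Y \<le> card ?DM + card U + card ?U1 + card ?U2 + card ?U3 + card (?S \<times> M) + card (M \<times> ?S)
      + card (?K \<times> M) + card (M \<times> ?K)"
    by (intro order_trans[OF card_Un_le] add_right_mono order_refl)
  also have "\<dots> \<le> card M + 230 * n + 230 * n + 230 * n + 230 * n + 3 * card M + card M * 3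
      + card ?K * card M + card M * card ?K"
    unfolding card_cartesian_product
    by (intro add_mono card_U U1 U2 U3 card_image_le LD(1) mult_right_mono mult_left_mono S3) auto
  also have "\<dots> \<le> 923 * n + 2 * (card ?K * card M)" using n_M by (simp add: mult.commute)
  finally have "25 * card ?Y \<le> 25 * (923 * n + 2 * (card ?K * card M))" by (rule mult_left_mono) simp
  also have "\<dots> = 23075 * n + card M * (50 * card ?K)" by simp
  also have "\<dots> \<le> 23075 * n + card M * n" using card_low_edges by (intro add_left_mono mult_left_mono) auto
  also have "\<dots> \<le> n * n"
  proof -
    have "23075 * n + card M * n = (23075 + card M) * n" by (simp add: algebra_simps)
    also have "\<dots> \<le> n * n" using n_M big by (intro mult_right_mono) auto
    finally show ?thesis .
  qed
  finally have Y25: "25 * card ?Y \<le> n\<^sup>2" by (simp add: power2_eq_square)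
  obtain h k r s where hk: "h \<in> M" "k \<in> M" "(h,k) \<notin> ?Y" "r \<in> h" "s \<in> k" "{c,r,s} \<in> E"
    using exists_linked_pair[OF c YM Y25] by (elim bexE conjE)
  have hk0: "h \<in> M0" "k \<in> M0" "h \<noteq> k" "h \<notin> ?S" "k \<notin> ?S" "(h,k) \<notin> U" using hk by auto
  obtain z where z: "dead_vertex E T h k z" using hk0 hk by (auto simp: undead_pairs_def)
  have zT: "z \<in> T" by (rule in_T[OF hk0(1-3) z])
  obtain v1 where v1: "dead_vertex E {x,p0,p} h k v1" using hk hk0 by (auto simp: undead_pairs_def)
  obtain v2 where v2: "dead_vertex E {x,p0,q} h k v2" using hk hk0 by (auto simp: undead_pairs_def)
  obtain v3 where v3: "dead_vertex E {c,p,q} h k v3" using hk hk0 by (auto simp: undead_pairs_def)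
  have ch: "card h = 3" "card k = 3" using LD(7) hk by auto
  have hT: "h \<inter> T = {}" "k \<inter> T = {}" using LD(10) hk by auto
  have notin: "x \<notin> h" "x \<notin> k" "c \<notin> h" "c \<notin> k" "p0 \<notin> h" "p0 \<notin> k" "p \<notin> h" "p \<notin> k" "q \<notin> h" "q \<notin> k"
  proof -
    have "h \<noteq> e0" "h \<noteq> e" "h \<noteq> f" "k \<noteq> e0" "k \<noteq> e" "k \<noteq> f" using hk0(4,5) by auto
    hence "h \<inter> e0 = {}" "k \<inter> e0 = {}" "h \<inter> e = {}" "k \<inter> e = {}" "h \<inter> f = {}" "k \<inter> f = {}"
      using LD(11) hk(1,2) Ms by metis+
    thus "p0 \<notin> h" "p0 \<notin> k" "p \<notin> h" "p \<notin> k" "q \<notin> h" "q \<notin> k" using p0 p q by blast+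
    show "x \<notin> h" "x \<notin> k" "c \<notin> h" "c \<notin> k" using hT x c by blast+
  qed
  have ne: "x \<noteq> p0" "x \<noteq> p" "p0 \<noteq> p" "x \<noteq> q" "p0 \<noteq> q" "c \<noteq> p" "c \<noteq> q" "p \<noteq> q"
    using x(1) c p0 p q LD(10)[OF Ms(1)] LD(10)[OF Ms(2)] LD(10)[OF Ms(3)]
      LD(11)[OF Ms(1,2) M0s(4)] LD(11)[OF Ms(1,3) M0s(5)] LD(11)[OF Ms(2,3) ef(3)] by blast+
  have hne: "h \<noteq> {}" "k \<noteq> {}" using hk by auto
  note T1 = triple_links[OF v1 ch _ _ ne(1,2,3)] and T2 = triple_links[OF v2 ch _ _ ne(1,4,5)]
    and T3 = triple_links[OF v3 ch _ _ ne(6,7,8)]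
  \<comment> \<open>The edge \<open>{c,r,s}\<close> excludes an empty link at
    \<open>c\<close>.\<close>
  have "c \<noteq> z" using dead_vertex_in_T(1)[OF z zT hT] hk by (auto simp: empty_link_def)
  hence fc: "full_link E h k c" using dead_vertex_in_T(2)[OF z zT hT c] by simp
  note nfe = not_full_and_empty[OF hne, of E]
  \<comment> \<open>If \<open>x\<close> has an empty link, then \<open>p\<close> and
    \<open>q\<close> have full links, as has \<open>c\<close>, and \<open>{c,p,q}\<close> has no
    vertex with an empty link. Otherwise \<open>p\<close> and \<open>q\<close> both have the type
    opposite to \<open>p0\<close>, whereas the full link of \<open>c\<close> requires their types to
    differ.\<close>
  show False
  proof (cases "z = x")
    case True
    hence "empty_link E h k x" using dead_vertex_in_T(1)[OF z zT hT] by simp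
    hence "full_link E h k p" "full_link E h k q" using T1(1) T2(1) notin by auto
    thus False using T3(2) fc notin nfe by auto
  next
    case False
    hence "full_link E h k x" using dead_vertex_in_T(2)[OF z zT hT x(1)] by simp
    thus False using T1(2) T2(2) T3(2) fc notin nfe by auto
  qed
qed

text \<open>Now dead vertices typically lie in the matching edges, and on a typical pair all vertices of a
  leftover triple have the same link as T. For three typical edges f, g, h this describes the
  triples between f, g and h in three incompatible ways.\<close>

lemma contradiction: False
proof -
  obtain h0 k0 a0 where "h0 \<in> M0" "k0 \<in> M0" "h0 \<noteq> k0" "a0 \<in> h0" "dead_vertex E T h0 k0 a0"
    using exists_dead_pair_in_M0 by blast
  hence cA: "card (A x) \<le> 470 * n" if "x \<in> T" for x using small_A_if_dead_pair that by blast
  let ?m = "card M0"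
  let ?A = "\<Union>x\<in>T. A x"
  have finA: "finite ?A" using LD(2) fin_A by auto
  have "card ?A \<le> (\<Sum>x\<in>T. card (A x))" using LD(2) by (rule card_UN_le)
  also have "\<dots> \<le> (\<Sum>x\<in>T. 470 * n)" by (intro sum_mono cA)
  finally have cUA: "card ?A \<le> 1410 * n" using LD(4) by simp
  have m: "25000000 \<le> ?m" using card_M0 big by linarith
  \<comment> \<open>\<open>Q\<close> asks for a dead vertex in the first edge; by symmetry the
    converse relation covers the second edge.\<close>
  define Q where "Q = {(e,f). e \<in> M0 \<and> f \<in> M0 \<and> e \<noteq> f \<and> (\<exists>a\<in>e. dead_vertex E T e f a)}"
  have Q: "Q \<subseteq> M0 \<times> M0" by (auto simp: Q_def)
  have finQ: "finite Q" by (rule finite_subset[OF Q]) (use fin_M0 in auto)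
  let ?D = "(\<lambda>e. (e,e)) ` M0"
  have "M0 \<times> M0 \<subseteq> ?D \<union> U \<union> ?A \<union> Q \<union> Q\<inverse>"
  proof (rule subrelI)
    fix e f assume ef: "(e,f) \<in> M0 \<times> M0"
    hence efM: "e \<in> M" "f \<in> M" using M0_M by auto
    show "(e,f) \<in> ?D \<union> U \<union> ?A \<union> Q \<union> Q\<inverse>"
    proof (cases "e = f \<or> (e,f) \<in> U")
      case False
      then obtain v where v: "dead_vertex E T e f v" using efM by (auto simp: undead_pairs_def)
      hence "v \<in> T \<or> v \<in> e \<or> v \<in> f" by (auto simp: dead_vertex_def)
      thus ?thesis using v dead_vertex_commute[OF v] ef efM False by (auto simp: Q_def A_def)
    qed (use ef in auto)
  qed
  hence "card (M0 \<times> M0) \<le> card (?D \<union> U \<union> ?A \<union> Q \<union> Q\<inverse>)"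
    using fin_M0 fin_U finA finQ by (intro card_mono) auto
  also have "\<dots> \<le> card ?D + card U + card ?A + card Q + card (Q\<inverse>)"
    by (intro order_trans[OF card_Un_le] add_right_mono order_refl)
  also have "\<dots> \<le> ?m + 230 * n + 1410 * n + card Q + card Q"
    using fin_M0 card_U cUA by (intro add_mono card_image_le) auto
  finally have cQ: "?m * ?m \<le> 6561 * ?m + 2 * card Q"
    using card_M0 by (simp add: card_cartesian_product)
  \<comment> \<open>\<open>Q\<close> has at least \<open>(?m^2 - 6561 * ?m) / 2\<close> pairs, which
    exceeds a quarter of \<open>?m^2\<close>.\<close>
  let ?c = "?m div 4"
  have "4 * (?c * ?m) \<le> ?m * ?m" using mult_right_mono[of "4 * ?c" ?m ?m] by simp
  moreover have "25000000 * ?m \<le> ?m * ?m" using m by (intro mult_right_mono) auto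
  ultimately have "?c * ?m < card Q" using cQ m by linarith
  then obtain e0 where e0: "e0 \<in> M0" "?c < card (Q `` {e0})"
    using card_gt_vertical_section[OF fin_M0 Q] by metis
  define N where "N = Q `` {e0}"
  have NM0: "N \<subseteq> M0" using Q by (auto simp: N_def)
  hence NM: "N \<subseteq> M" using M0_M by auto
  have finN: "finite N" using finite_subset[OF NM0 fin_M0] .
  have N4: "?m \<le> 4 * card N" using e0(2) unfolding N_def by linarith
  have nN: "n \<le> 16 * card N" using N4 card_M0 by linarith
  have e0M: "e0 \<in> M" using e0 M0_M by auto
  have e0N: "e0 \<notin> N" by (auto simp: N_def Q_def)
  have "\<forall>f\<in>N. \<exists>a. a \<in> e0 \<and> dead_vertex E T e0 f a" by (auto simp: N_def Q_def)
  then obtain d where "\<forall>f\<in>N. d f \<in> e0 \<and> dead_vertex E T e0 f (d f)" by (rule bchoice[THEN exE])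
  hence d: "d f \<in> e0" "dead_vertex E T e0 f (d f)" if "f \<in> N" for f using that by auto
  obtain x where x: "x \<in> T" using card_3_avoid LD(4) by metis
  \<comment> \<open>The dead vertex \<open>d f\<close> lies in \<open>e0\<close>, so every
    \<open>y\<close> in \<open>f\<close> belongs to a leftover triple \<open>{x, d f, y}\<close>
    that shares \<open>x\<close> with \<open>T\<close>.\<close>
  define UT where "UT f y = undead_pairs E {x, d f, y} (M - {e0,f})" for f y
  define B where "B f = (N \<times> N) \<inter> ((\<lambda>g. (g,g)) ` N \<union> {f} \<times> N \<union> N \<times> {f} \<union> U \<union> ?A \<union> (\<Union>y\<in>f. UT f y))" for f
  have cUT: "card (UT f y) \<le> 230 * n" if "f \<in> N" "y \<in> f" for f y
    unfolding UT_def
  proof (rule card_undead_pairs_exchange_le[OF L e0M _ _ d(2)[OF that(1)] x d(1)[OF that(1)] that(2)])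
    show "f \<in> M" "e0 \<noteq> f" "9 \<le> n" using that NM e0N big by auto
    show "\<not> low x" "\<not> low (d f)" "\<not> low y" using T_not_low x M0_not_low e0(1) d that NM0 by auto
  qed simp
  have finUT: "finite (UT f y)" for f y unfolding UT_def using LD(1) by (intro finite_undead_pairs) auto
  have cB: "card (B f) \<le> 40000 * card N" if f: "f \<in> N" for f
  proof -
    have ff: "finite f" "card f = 3" using LD(7,8) NM f by auto
    have "card (\<Union>y\<in>f. UT f y) \<le> (\<Sum>y\<in>f. card (UT f y))" using ff(1) by (rule card_UN_le)
    also have "\<dots> \<le> (\<Sum>y\<in>f. 230 * n)" by (intro sum_mono cUT f)
    finally have cUUT: "card (\<Union>y\<in>f. UT f y) \<le> 690 * n" using ff by simp
    have "card (B f) \<le> card ((\<lambda>g. (g,g)) ` N \<union> {f} \<times> N \<union> N \<times> {f} \<union> U \<union> ?A \<union> (\<Union>y\<in>f. UT f y))"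
      unfolding B_def using finN fin_U finA finUT ff by (intro card_mono) auto
    also have "\<dots> \<le> card ((\<lambda>g. (g,g)) ` N) + card ({f} \<times> N) + card (N \<times> {f}) + card U + card ?A + card (\<Union>y\<in>f. UT f y)"
      by (intro order_trans[OF card_Un_le] add_right_mono order_refl)
    also have "\<dots> \<le> card N + card N + card N + 230 * n + 1410 * n + 690 * n"
      using finN card_U cUA cUUT by (intro add_mono card_image_le) (auto simp: card_cartesian_product)
    \<comment> \<open>By \<open>n \<le> 16 * card N\<close> the factor is at most
      \<open>3 + 16 * 2330 = 37283\<close>.\<close>
    also have "\<dots> \<le> 40000 * card N" using nN by linarith
    finally show ?thesis .
  qed
  have BN: "B f \<subseteq> N \<times> N" for f by (auto simp: B_def)
  have cN: "3 * 40000 < card N" using N4 m by linarith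
  obtain f g h where fgh: "f \<in> N" "g \<in> N" "h \<in> N" "(g,h) \<notin> B f" "(f,h) \<notin> B g" "(f,g) \<notin> B h"
    by (rule exists_triple_avoiding[of N B, OF finN BN cB cN])
  \<comment> \<open>The link of the common vertex \<open>x\<close> determines the dead vertex, so
    \<open>T\<close> and \<open>{x, d f, y}\<close> have the same one on \<open>(g,h)\<close>, and
    \<open>y\<close> inherits the link of \<open>x\<close>.\<close>
  have slice: "\<exists>v\<in>g\<union>h. \<forall>y\<in>f. \<forall>r\<in>g. \<forall>s\<in>h. {y,r,s} \<in> E \<longleftrightarrow> v \<noteq> r \<and> v \<noteq> s"
    if fgh: "f \<in> N" "g \<in> N" "h \<in> N" "(g,h) \<notin> B f" for f g h
  proof -
    have ne: "g \<noteq> h" "g \<noteq> f" "h \<noteq> f" "(g,h) \<notin> U" "(g,h) \<notin> ?A" and nUT: "\<And>y. y \<in> f \<Longrightarrow> (g,h) \<notin> UT f y"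
      using fgh unfolding B_def by auto
    have M: "f \<in> M" "g \<in> M" "h \<in> M" using fgh NM by auto
    obtain v where v: "dead_vertex E T g h v" using ne M by (auto simp: undead_pairs_def)
    have "v \<notin> T" using ne v M by (auto simp: A_def)
    hence vgh: "v \<in> g \<union> h" using v by (auto simp: dead_vertex_def)
    have c: "card g = 3" "card h = 3" "g \<inter> h = {}" using LD(7,11) M ne by auto
    have xlink: "{x,r,s} \<in> E \<longleftrightarrow> v \<noteq> r \<and> v \<noteq> s" if "r \<in> g" "s \<in> h" for r s
      using v x that \<open>v \<notin> T\<close> unfolding dead_vertex_def by auto
    have "{y,r,s} \<in> E \<longleftrightarrow> v \<noteq> r \<and> v \<noteq> s" if yrs: "y \<in> f" "r \<in> g" "s \<in> h" for y r s
    proof -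
      have "g \<in> M - {e0,f}" "h \<in> M - {e0,f}" using M ne fgh e0N by auto
      then obtain w where w: "dead_vertex E {x, d f, y} g h w"
        using nUT[OF yrs(1)] ne(1) by (auto simp: UT_def undead_pairs_def)
      have xw: "{x,r,s} \<in> E \<longleftrightarrow> w \<notin> {x,r,s}" if "r \<in> g" "s \<in> h" for r s
        using w that unfolding dead_vertex_def by blast
      have "w = v"
      proof (rule ccontr)
        assume "w \<noteq> v"
        obtain r' s' where rs': "r' \<in> g" "r' \<noteq> v" "s' \<in> h" "s' \<noteq> v" using c card_3_avoid by metis
        \<comment> \<open>Some edge passes through \<open>x\<close>, so \<open>x\<close> is not
          dead. Below, \<open>w\<close> must lie in every transversal through \<open>x\<close> and
          \<open>v\<close>, which fails once the third vertex is varied.\<close>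
        have xw': "x \<noteq> w" using xw[of r' s'] xlink[of r' s'] rs' by auto
        from vgh show False
        proof
          assume vg: "v \<in> g"
          have "{x,v,s} \<notin> E" if "s \<in> h" for s using xlink[OF vg that] by simp
          hence "w \<in> {x,v,s}" if "s \<in> h" for s using xw[OF vg that] that by blast
          moreover obtain s where "s \<in> h" "s \<noteq> w" using card_3_avoid c by metis
          ultimately show False using xw' \<open>w \<noteq> v\<close> by auto
        next
          assume vh: "v \<in> h"
          have "{x,r,v} \<notin> E" if "r \<in> g" for r using xlink[OF that vh] by simp
          hence "w \<in> {x,r,v}" if "r \<in> g" for r using xw[OF that vh] that by blast
          moreover obtain r where "r \<in> g" "r \<noteq> w" using card_3_avoid c by metis
          ultimately show False using xw' \<open>w \<noteq> v\<close> by auto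
        qed
      qed
      moreover have "v \<noteq> y" using vgh yrs LD(11)[OF M(1,2)] LD(11)[OF M(1,3)] ne by auto
      ultimately show ?thesis using w yrs unfolding dead_vertex_def by auto
    qed
    thus ?thesis using vgh by blast
  qed
  obtain d1 where d1: "d1 \<in> g \<union> h" "\<forall>y\<in>f. \<forall>r\<in>g. \<forall>s\<in>h. {y,r,s} \<in> E \<longleftrightarrow> d1 \<noteq> r \<and> d1 \<noteq> s"
    using slice[OF fgh(1,2,3,4)] by blast
  obtain d2 where d2: "\<forall>y\<in>g. \<forall>r\<in>f. \<forall>s\<in>h. {y,r,s} \<in> E \<longleftrightarrow> d2 \<noteq> r \<and> d2 \<noteq> s"
    using slice[OF fgh(2,1,3,5)] by blast
  obtain d3 where d3: "\<forall>y\<in>h. \<forall>r\<in>f. \<forall>s\<in>g. {y,r,s} \<in> E \<longleftrightarrow> d3 \<noteq> r \<and> d3 \<noteq> s"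
    using slice[OF fgh(3,1,2,6)] by blast
  have perm: "{r,p,s} = {p,r,s}" "{s,p,r} = {p,r,s}" for p r s :: 'a by auto
  show False
  proof (rule inconsistent_slices[of f g h d1 E d2 d3])
    show "card f = 3" "card g = 3" "card h = 3" using LD(7) NM fgh by auto
    show "d1 \<in> g \<union> h" by (fact d1(1))
    fix p r s assume prs: "p \<in> f" "r \<in> g" "s \<in> h"
    show "({p,r,s} \<in> E) = (d1 \<noteq> r \<and> d1 \<noteq> s)" using d1(2) prs by blast
    show "({p,r,s} \<in> E) = (d2 \<noteq> p \<and> d2 \<noteq> s)" using d2 prs perm(1)[of r p s] by metis
    show "({p,r,s} \<in> E) = (d3 \<noteq> p \<and> d3 \<noteq> r)" using d3 prs perm(2)[of s p r] by metis
  qed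
qed

end

section \<open>Saturated hypergraphs\<close>

lemma triple_partition:
  assumes "finite R" "3 dvd card R"
  shows "\<exists>M. disjoint M \<and> \<Union>M = R \<and> (\<forall>e\<in>M. card e = 3)"
  using assms
proof (induction "card R" arbitrary: R rule: less_induct)
  case less
  show ?case
  proof (cases "R = {}")
    case True
    thus ?thesis by (intro exI[of _ "{}"]) auto
  next
    case False
    have "3 \<le> card R" using less.prems False by (auto dest: dvd_imp_le simp: card_gt_0_iff)
    then obtain t where t: "t \<subseteq> R" "card t = 3" "finite t" by (rule obtain_subset_with_card_n)
    have c: "card (R - t) = card R - 3" using t less.prems by (simp add: card_Diff_subset)
    hence "card (R - t) < card R" using \<open>3 \<le> card R\<close> by simp
    moreover have "3 dvd card (R - t)" unfolding c using less.prems(2) by (simp add: dvd_diff_nat)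
    ultimately obtain M where M: "disjoint M" "\<Union>M = R - t" "\<forall>e\<in>M. card e = 3"
      using less.hyps less.prems(1) by (metis finite_Diff)
    have "disjoint (insert t M)" using M(1,2) by (auto simp: disjoint_def)
    thus ?thesis using M t by (intro exI[of _ "insert t M"]) auto
  qed
qed

text \<open>A Hall-type condition: in order of size, the \<open>i\<close>-th set has at least
  \<open>2 * i\<close> elements, and at most \<open>2 * (i - 1)\<close> of them are used before its
  turn.\<close>

lemma disjoint_pairs_greedy:
  fixes N :: "'a \<Rightarrow> 'b set"
  assumes "finite W" "\<And>w. w \<in> W \<Longrightarrow> finite (N w)"
    and "\<And>i. 0 < i \<Longrightarrow> card {w \<in> W. card (N w) < 2 * i} < i"
  shows "\<exists>P. (\<forall>w\<in>W. P w \<subseteq> N w \<and> card (P w) = 2) \<and> (\<forall>w\<in>W. \<forall>w'\<in>W. w \<noteq> w' \<longrightarrow> P w \<inter> P w' = {})"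
  using assms
proof (induction W rule: finite_ranking_induct[where f = "\<lambda>w. card (N w)"])
  case empty
  thus ?case by auto
next
  case (insert x S)
  show ?case
  proof (cases "x \<in> S")
    case True
    thus ?thesis using insert.IH insert.prems by (simp add: insert_absorb)
  next
    case False
    have "card {w \<in> S. card (N w) < 2 * i} < i" if "0 < i" for i
    proof -
      have "card {w \<in> S. card (N w) < 2 * i} \<le> card {w \<in> insert x S. card (N w) < 2 * i}"
        using insert.hyps(1) by (intro card_mono) auto
      thus ?thesis using insert.prems(2)[OF that] by simp
    qed
    moreover have "finite (N w)" if "w \<in> S" for w using insert.prems(1) that by simp
    ultimately have "\<exists>P. (\<forall>w\<in>S. P w \<subseteq> N w \<and> card (P w) = 2) \<and>
        (\<forall>w\<in>S. \<forall>w'\<in>S. w \<noteq> w' \<longrightarrow> P w \<inter> P w' = {})"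
      by (intro insert.IH)
    then obtain P
      where P': "\<forall>w\<in>S. P w \<subseteq> N w \<and> card (P w) = 2" "\<forall>w\<in>S. \<forall>w'\<in>S. w \<noteq> w' \<longrightarrow> P w \<inter> P w' = {}"
      by (elim exE conjE)
    have P: "P w \<subseteq> N w \<and> card (P w) = 2" if "w \<in> S" for w using P'(1) that by simp
    have dP: "P w \<inter> P w' = {}" if "w \<in> S" "w' \<in> S" "w \<noteq> w'" for w w' using P'(2) that by simp
    let ?s = "card (insert x S)"
    have s: "?s = Suc (card S)" using False insert.hyps(1) by simp
    \<comment> \<open>The hypothesis for \<open>i = ?s\<close> yields some set of size at least
      \<open>2 * ?s\<close>; the induction adds the largest set last, so \<open>N x\<close> is at
      least that large.\<close>
    have "{w \<in> insert x S. card (N w) < 2 * ?s} \<noteq> insert x S"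
      using insert.prems(2)[of ?s] s by force
    then obtain w where "w \<in> insert x S" "2 * ?s \<le> card (N w)" by force
    hence x: "2 * ?s \<le> card (N x)" using insert.hyps(2) by force
    have "card (\<Union>w\<in>S. P w) \<le> (\<Sum>w\<in>S. card (P w))" using insert.hyps(1) by (rule card_UN_le)
    also have "\<dots> = 2 * card S" using P by simp
    finally have "2 \<le> card (N x) - card (\<Union>w\<in>S. P w)" using x s by simp
    also have "\<dots> \<le> card (N x - (\<Union>w\<in>S. P w))"
    proof (rule diff_card_le_card_Diff)
      show "finite (\<Union>w\<in>S. P w)"
        using P insert.hyps(1) by (metis card.infinite finite_UN_I zero_neq_numeral)
    qed
    finally obtain Q where Q: "Q \<subseteq> N x - (\<Union>w\<in>S. P w)" "card Q = 2" "finite Q" by (rule obtain_subset_with_card_n)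
    show ?thesis
    proof (intro exI[of _ "P(x := Q)"] conjI ballI impI)
      fix w assume "w \<in> insert x S"
      thus "(P(x := Q)) w \<subseteq> N w" "card ((P(x := Q)) w) = 2" using P Q by auto
      fix w' assume "w' \<in> insert x S" "w \<noteq> w'"
      thus "(P(x := Q)) w \<inter> (P(x := Q)) w' = {}" using \<open>w \<in> insert x S\<close> dP Q(1) False by auto
    qed
  qed
qed

lemma two_choose_two: "2 * (m choose 2) = m * (m - 1)" for m :: nat
  using choose_two[of m] by (cases m) auto

text \<open>For disjoint \<open>S\<close> and \<open>W\<close> and \<open>N w\<close> inside
  \<open>S\<close>, this is the largest 3-graph on their union in which vertices of \<open>W\<close>
  are pairwise non-adjacent and each \<open>w\<close> has all its neighbours in
  \<open>N w\<close>.\<close>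

definition closure_edges :: "'a set \<Rightarrow> 'a set \<Rightarrow> ('a \<Rightarrow> 'a set) \<Rightarrow> 'a set set" where
  "closure_edges S W N = {t. t \<subseteq> S \<and> card t = 3} \<union> {insert w P | w P. w \<in> W \<and> P \<subseteq> N w \<and> card P = 2}"

section \<open>Degrees in the saturated hypergraph\<close>

locale star_closure =
  fixes S W :: "'a set" and N :: "'a \<Rightarrow> 'a set"
  assumes fin: "finite S" "finite W" and SW: "S \<inter> W = {}" and NS: "w \<in> W \<Longrightarrow> N w \<subseteq> S"
begin

abbreviation "F \<equiv> closure_edges S W N"

lemma fin_N: "w \<in> W \<Longrightarrow> finite (N w)" using NS fin finite_subset by blast

lemma closure_edge_finite: "finite F"
  by (rule finite_subset[of _ "Pow (S \<union> W)"]) (use NS fin in \<open>auto simp: closure_edges_def\<close>)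

lemma hdeg_star:
  assumes w: "w \<in> W" shows "2 * hdeg F w \<le> card (N w) * (card (N w) - 1)"
proof -
  let ?A = "{P. P \<subseteq> N w \<and> card P = 2}"
  have finA: "finite ?A" by (rule finite_subset[of _ "Pow (N w)"]) (use fin_N[OF w] in auto)
  have "{e \<in> F. w \<in> e} \<subseteq> insert w ` ?A"
  proof
    fix e assume "e \<in> {e \<in> F. w \<in> e}"
    hence e: "e \<in> F" "w \<in> e" by auto
    have "\<not> e \<subseteq> S" using e(2) w SW by auto
    then obtain w' P where P: "e = insert w' P" "w' \<in> W" "P \<subseteq> N w'" "card P = 2"
      using e(1) by (auto simp: closure_edges_def)
    have "w \<notin> P" using P(3) NS[OF P(2)] w SW by auto
    hence "w' = w" using e(2) P(1) by auto
    thus "e \<in> insert w ` ?A" using P by blast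
  qed
  hence "hdeg F w \<le> card (insert w ` ?A)" unfolding hdeg_def using finA by (intro card_mono) auto
  also have "\<dots> \<le> card ?A" using finA by (rule card_image_le)
  also have "\<dots> = card (N w) choose 2" by (rule n_subsets[OF fin_N[OF w]])
  finally show ?thesis using two_choose_two[of "card (N w)"] by linarith
qed

text \<open>Edges at \<open>u\<close> inside \<open>S\<close> correspond to pairs in
  \<open>S - {u}\<close>; those with a vertex \<open>w\<close> of \<open>W\<close> correspond to a
  second neighbour of \<open>w\<close>.\<close>

lemma hdeg_core:
  assumes u: "u \<in> S"
  shows "2 * hdeg F u \<le> (card S - 1) * (card S - 2) + 2 * (\<Sum>w\<in>W. card (N w) - 1)"
proof -
  let ?A = "{P. P \<subseteq> S - {u} \<and> card P = 2}"
  let ?B = "\<lambda>w. if u \<in> N w then (\<lambda>v. {w,u,v}) ` (N w - {u}) else {}"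
  have finA: "finite ?A" by (rule finite_subset[of _ "Pow S"]) (use fin in auto)
  have cB: "card (?B w) \<le> card (N w) - 1" if "w \<in> W" for w
    using card_image_le[of "N w - {u}" "\<lambda>v. {w,u,v}"] fin_N[OF that] by auto
  have "{e \<in> F. u \<in> e} \<subseteq> insert u ` ?A \<union> (\<Union>w\<in>W. ?B w)"
  proof
    fix e assume "e \<in> {e \<in> F. u \<in> e}"
    hence e: "e \<in> F" "u \<in> e" by auto
    from e(1) consider "e \<subseteq> S" "card e = 3" | w P where "e = insert w P" "w \<in> W" "P \<subseteq> N w" "card P = 2"
      by (auto simp: closure_edges_def)
    thus "e \<in> insert u ` ?A \<union> (\<Union>w\<in>W. ?B w)"
    proof cases
      case 1
      hence "e - {u} \<in> ?A" "e = insert u (e - {u})" using e(2) by auto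
      thus ?thesis by blast
    next
      case 2
      have "u \<noteq> w" using 2(2) u SW by auto
      hence uP: "u \<in> P" using e(2) 2(1) by auto
      then obtain v where v: "P = {u,v}" "v \<noteq> u" using 2(4) by (auto simp: card_2_iff)
      hence "e \<in> ?B w" using 2 by auto
      thus ?thesis using 2(2) by blast
    qed
  qed
  hence "hdeg F u \<le> card (insert u ` ?A \<union> (\<Union>w\<in>W. ?B w))"
    unfolding hdeg_def using finA fin_N fin by (intro card_mono) auto
  also have "\<dots> \<le> card (insert u ` ?A) + card (\<Union>w\<in>W. ?B w)" by (rule card_Un_le)
  also have "card (insert u ` ?A) \<le> card ?A" using finA by (rule card_image_le)
  also have "card ?A = (card S - 1) choose 2" using n_subsets[of "S - {u}" 2] fin u by simp
  also have "card (\<Union>w\<in>W. ?B w) \<le> (\<Sum>w\<in>W. card (?B w))" using fin by (intro card_UN_le)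
  also have "\<dots> \<le> (\<Sum>w\<in>W. card (N w) - 1)" by (intro sum_mono cB)
  finally have "hdeg F u \<le> ((card S - 1) choose 2) + (\<Sum>w\<in>W. card (N w) - 1)" by simp
  moreover have "card S - 1 - 1 = card S - 2" by simp
  ultimately show ?thesis using two_choose_two[of "card S - 1"] by simp
qed

section \<open>A perfect matching from the sharp degree condition on \<open>3 * k\<close>
  vertices\<close>

context
  fixes k :: nat
  assumes card_SW: "card S + card W = 3 * k" and N_ne: "w \<in> W \<Longrightarrow> N w \<noteq> {}"
    and deg: "\<lbrakk>w \<in> W; u \<in> N w\<rbrakk> \<Longrightarrow> 6 * k\<^sup>2 + 2 < hdeg F w + hdeg F u + 8 * k"
begin

text \<open>The extremal case is \<open>card W = k + 1\<close> with every \<open>N w\<close> equal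
  to \<open>S\<close>: this is the hypergraph \<open>H^*\<close>, whose degree sum is exactly the
  excluded value \<open>6 * k^2 - 8 * k + 2\<close>.\<close>

lemma card_W_le: "card W \<le> k"
proof (rule ccontr)
  assume *: "\<not> ?thesis"
  then obtain w where w: "w \<in> W" by fastforce
  then obtain u where u: "u \<in> N w" using N_ne by auto
  hence uS: "u \<in> S" using NS w by auto
  let ?t = "card S" and ?s = "card W"
  have t1: "1 \<le> ?t" using uS fin by (metis One_nat_def Suc_leI card_gt_0_iff empty_iff)
  have Nt: "card (N w) \<le> ?t" if "w \<in> W" for w using NS[OF that] fin by (intro card_mono)
  have "2 * hdeg F w \<le> ?t * (?t - 1)"
    using hdeg_star[OF w] mult_mono[OF Nt[OF w] diff_le_mono[OF Nt[OF w], of 1]] by linarith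
  moreover have "(\<Sum>w\<in>W. card (N w) - 1) \<le> (\<Sum>w\<in>W. ?t - 1)" by (intro sum_mono diff_le_mono Nt)
  hence "2 * hdeg F u \<le> (?t - 1) * (?t - 2) + 2 * (?s * (?t - 1))" using hdeg_core[OF uS] by simp
  ultimately have le: "2 * (hdeg F w + hdeg F u) \<le> ?t * (?t - 1) + (?t - 1) * (?t - 2) + 2 * (?s * (?t - 1))"
    by simp
  obtain t where t: "?t = Suc t" using t1 by (cases ?t) auto
  have tk: "t + 2 \<le> 2 * k" using * card_SW t by linarith
  \<comment> \<open>The case split on \<open>t\<close> here and below concerns the truncated
    subtraction \<open>t - 1\<close> at \<open>t = 0\<close>.\<close>
  have "?t * (?t - 1) + (?t - 1) * (?t - 2) + 2 * (?s * (?t - 1)) = t * (Suc t + (t - 1) + 2 * ?s)"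
    unfolding t by (cases t) (simp_all add: algebra_simps)
  also have "\<dots> = 2 * (t * (3 * k - 1))"
  proof (cases t)
    case (Suc t')
    have "Suc t + (t - 1) + 2 * ?s = 2 * (3 * k - 1)" using Suc t card_SW by linarith
    thus ?thesis by (metis mult.left_commute)
  qed simp
  also have "\<dots> \<le> 2 * ((2 * k - 2) * (3 * k - 1))"
    using tk by (intro mult_left_mono mult_right_mono) auto
  finally have "2 * (hdeg F w + hdeg F u) \<le> 2 * ((2 * k - 2) * (3 * k - 1))" by (rule order_trans[OF le])
  hence "hdeg F w + hdeg F u \<le> (2 * k - 2) * (3 * k - 1)" unfolding mult_le_cancel1 by simp
  moreover have "1 \<le> k" using tk by linarith
  ultimately have "hdeg F w + hdeg F u + 8 * k \<le> 6 * k\<^sup>2 + 2"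
    by (cases k) (auto simp: power2_eq_square algebra_simps)
  thus False using deg[OF w u] by simp
qed

text \<open>This is the hypothesis of \<open>disjoint_pairs_greedy\<close>. If \<open>i\<close>
  vertices of \<open>W\<close> have fewer than \<open>2 * i\<close> neighbours, then such a vertex
  \<open>w\<close> has small degree, and all of these vertices together lower the bound on the
  degree of a neighbour \<open>u\<close>.\<close>

lemma few_small_stars:
  assumes i: "0 < i" shows "card {w \<in> W. card (N w) < 2 * i} < i"
proof (rule ccontr)
  assume *: "\<not> ?thesis"
  let ?t = "card S" and ?s = "card W"
  let ?A = "{w \<in> W. card (N w) < 2 * i}"
  obtain j where j: "i = Suc j" using i by (cases i) auto
  have A: "Suc j \<le> card ?A" using * j by simp
  have As: "card ?A \<le> ?s" using fin by (intro card_mono) auto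
  have js: "Suc j \<le> ?s" using A As by simp
  have "?A \<noteq> {}" using A by force
  then obtain w where w: "w \<in> ?A" by auto
  then obtain u where u: "u \<in> N w" using N_ne by auto
  hence uS: "u \<in> S" using NS w by auto
  have sk: "?s \<le> k" by (rule card_W_le)
  have tj: "2 * j \<le> ?t - 1" using js sk card_SW by linarith
  have "card (N w) * (card (N w) - 1) \<le> (2 * j + 1) * (2 * j)"
    using w j by (intro mult_mono) auto
  hence dw: "2 * hdeg F w \<le> (2 * j + 1) * (2 * j)" using hdeg_star[of w] w by simp
  have Nt: "card (N w) - 1 \<le> ?t - 1" if "w \<in> W" for w
    using NS[OF that] fin by (intro diff_le_mono card_mono)
  have "(\<Sum>w\<in>W. card (N w) - 1) = (\<Sum>w\<in>?A. card (N w) - 1) + (\<Sum>w\<in>W - ?A. card (N w) - 1)"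
    using fin by (subst sum.subset_diff[of ?A W]) auto
  also have "\<dots> \<le> (\<Sum>w\<in>?A. 2 * j) + (\<Sum>w\<in>W - ?A. ?t - 1)"
    using j Nt by (intro add_mono sum_mono) auto
  also have "\<dots> = card ?A * (2 * j) + (?s - card ?A) * (?t - 1)"
    using fin by (simp add: card_Diff_subset)
  \<comment> \<open>If more than \<open>Suc j\<close> neighbourhoods are small, the surplus ones are
    bounded by the larger value \<open>?t - 1\<close>.\<close>
  also have "\<dots> \<le> Suc j * (2 * j) + (?s - Suc j) * (?t - 1)"
  proof -
    obtain a where a: "card ?A = Suc j + a" using A le_Suc_ex by blast
    have "?s - Suc j = (?s - card ?A) + a" using a As by simp
    hence "(?s - Suc j) * (?t - 1) = (?s - card ?A) * (?t - 1) + a * (?t - 1)" by (simp add: algebra_simps)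
    moreover have "a * (2 * j) \<le> a * (?t - 1)" using tj by (rule mult_left_mono) simp
    moreover have "card ?A * (2 * j) = Suc j * (2 * j) + a * (2 * j)" unfolding a by (rule distrib_right)
    ultimately show ?thesis by linarith
  qed
  finally have "2 * (\<Sum>w\<in>W. card (N w) - 1) \<le> 2 * (Suc j * (2 * j) + (?s - Suc j) * (?t - 1))"
    by (rule mult_left_mono) simp
  hence "2 * hdeg F u \<le> (?t - 1) * (?t - 2) + 2 * (Suc j * (2 * j) + (?s - Suc j) * (?t - 1))"
    by (intro order_trans[OF hdeg_core[OF uS]] add_left_mono)
  with dw have le: "2 * hdeg F w + 2 * hdeg F u \<le>
      (2 * j + 1) * (2 * j) + ((?t - 1) * (?t - 2) + 2 * (Suc j * (2 * j) + (?s - Suc j) * (?t - 1)))"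
    by (rule add_mono)
  \<comment> \<open>Integers replace the truncated differences; \<open>J\<close> is the largest
    possible value of \<open>x\<close>.\<close>
  define J K x where "J = int ?s - 1" and "K = int k" and "x = int j"
  have t2: "2 \<le> ?t" using js sk card_SW by linarith
  have T: "int ?t = 3 * K - 1 - J" using card_SW by (simp add: J_def K_def)
  have diffs: "int (?t - 1) = 3 * K - 2 - J" "int (?t - 2) = 3 * K - 3 - J" "int (?s - Suc j) = J - x"
    using t2 js T by (auto simp: of_nat_diff J_def x_def)
  have bnds: "0 \<le> x" "x \<le> J" "J \<le> K - 1" "1 \<le> K" using js sk by (auto simp: J_def K_def x_def)
  have "int (2 * hdeg F w + 2 * hdeg F u) \<le> int ((2 * j + 1) * (2 * j) + ((?t - 1) * (?t - 2)
      + 2 * (Suc j * (2 * j) + (?s - Suc j) * (?t - 1))))"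
    using le by (rule zle_int[THEN iffD2])
  also have "\<dots> = (2 * x + 1) * (2 * x) + (3 * K - 2 - J) * (3 * K - 3 - J)
      + 2 * ((x + 1) * (2 * x) + (J - x) * (3 * K - 2 - J))"
    by (simp only: of_nat_add of_nat_mult diffs) (simp add: x_def algebra_simps)
  also have "\<dots> = x * (8 * x + 6) + (3 * K - 2 - J) * (3 * K - 3 - J) + 2 * ((J - x) * (3 * K - 2 - J))"
    by (simp add: algebra_simps)
  \<comment> \<open>The convex term is replaced by its chord on \<open>[0, J]\<close>. The result is
    linear in \<open>x\<close>, and the case split decides which endpoint is larger. Equality with
    the final bound occurs at \<open>x = J = K - 1\<close>.\<close>
  also have "\<dots> \<le> x * (8 * J + 6) + (3 * K - 2 - J) * (3 * K - 3 - J) + 2 * ((J - x) * (3 * K - 2 - J))"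
    using bnds by (intro add_right_mono mult_left_mono) auto
  also have "\<dots> \<le> 12 * K\<^sup>2 - 16 * K + 4"
  proof (cases "2 * (3 * K - 2 - J) \<le> 8 * J + 6")
    case True
    have "(J - x) * (2 * (3 * K - 2 - J)) \<le> (J - x) * (8 * J + 6)"
      using True bnds by (intro mult_left_mono) auto
    moreover have "J * (9 * J) \<le> J * (9 * K - 9)" using bnds by (intro mult_left_mono) auto
    moreover have "J * (3 * K + 2) \<le> (K - 1) * (3 * K + 2)" using bnds by (intro mult_right_mono) auto
    ultimately show ?thesis by (simp add: algebra_simps power2_eq_square)
  next
    case False
    have "x * (8 * J + 6) \<le> x * (2 * (3 * K - 2 - J))" using False bnds by (intro mult_left_mono) auto
    moreover have "J \<le> J * J"
    proof (cases "J = 0")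
      case False
      hence "1 * J \<le> J * J" using bnds by (intro mult_right_mono) auto
      thus ?thesis by simp
    qed simp
    moreover have "K + 2 \<le> K * (K * 3)" using mult_left_mono[of 3 "K * 3" K] bnds by linarith
    ultimately show ?thesis using bnds by (simp add: algebra_simps power2_eq_square)
  qed
  finally have "int (hdeg F w + hdeg F u) + 8 * K \<le> 6 * K\<^sup>2 + 2" by simp
  hence "hdeg F w + hdeg F u + 8 * k \<le> 6 * k\<^sup>2 + 2"
    unfolding K_def by (metis (mono_tags, lifting) of_nat_add of_nat_le_iff of_nat_mult of_nat_numeral of_nat_power)
  thus False using deg[of w u] w u by simp
qed

text \<open>Each vertex of \<open>W\<close> is matched with a private pair of neighbours. The
  \<open>3 * (k - card W)\<close> vertices of \<open>S\<close> left over can be split into triples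
  arbitrarily.\<close>

lemma closure_perfect_matching: "\<exists>M. perfect_matching (S \<union> W) F M"
proof -
  have "\<exists>P. (\<forall>w\<in>W. P w \<subseteq> N w \<and> card (P w) = 2) \<and> (\<forall>w\<in>W. \<forall>w'\<in>W. w \<noteq> w' \<longrightarrow> P w \<inter> P w' = {})"
    by (rule disjoint_pairs_greedy[OF fin(2) fin_N few_small_stars])
  then obtain P where P': "\<forall>w\<in>W. P w \<subseteq> N w \<and> card (P w) = 2"
    "\<forall>w\<in>W. \<forall>w'\<in>W. w \<noteq> w' \<longrightarrow> P w \<inter> P w' = {}"
    by (elim exE conjE)
  have P: "P w \<subseteq> N w" "card (P w) = 2" if "w \<in> W" for w using P'(1) that by auto
  have dP: "P w \<inter> P w' = {}" if "w \<in> W" "w' \<in> W" "w \<noteq> w'" for w w' using P'(2) that by simp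
  let ?Q = "\<Union>w\<in>W. P w"
  have QS: "?Q \<subseteq> S" using P(1) NS by blast
  have finP: "finite (P w)" if "w \<in> W" for w using P(1) fin_N that finite_subset by blast
  have "card ?Q = (\<Sum>w\<in>W. card (P w))" using fin finP dP by (intro card_UN_disjoint) auto
  hence cQ: "card ?Q = 2 * card W" using P(2) by simp
  have "card (S - ?Q) = card S - 2 * card W" using cQ QS fin by (metis card_Diff_subset finite_subset)
  also have "\<dots> = 3 * (k - card W)" using card_SW by simp
  finally have "3 dvd card (S - ?Q)" by simp
  then obtain M where M: "disjoint M" "\<Union>M = S - ?Q" "\<forall>e\<in>M. card e = 3"
    using triple_partition[of "S - ?Q"] fin by auto
  have 1: "perfect_matching (S - ?Q) F M"
    using M unfolding perfect_matching_def closure_edges_def by auto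
  have PS: "P w \<inter> W = {}" if "w \<in> W" for w using P(1)[OF that] NS[OF that] SW by auto
  have "disjoint ((\<lambda>w. insert w (P w)) ` W)"
  proof (rule disjointI)
    fix a b assume "a \<in> (\<lambda>w. insert w (P w)) ` W" "b \<in> (\<lambda>w. insert w (P w)) ` W" "a \<noteq> b"
    then obtain w w' where w: "a = insert w (P w)" "b = insert w' (P w')" "w \<in> W" "w' \<in> W" "w \<noteq> w'" by blast
    thus "a \<inter> b = {}" using dP[OF w(3-5)] PS[OF w(3)] PS[OF w(4)] by auto
  qed
  moreover have "(\<lambda>w. insert w (P w)) ` W \<subseteq> F"
    using P(1,2) unfolding closure_edges_def by blast
  ultimately have 2: "perfect_matching (W \<union> ?Q) F ((\<lambda>w. insert w (P w)) ` W)"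
    unfolding perfect_matching_def by auto
  have "perfect_matching ((S - ?Q) \<union> (W \<union> ?Q)) F (M \<union> (\<lambda>w. insert w (P w)) ` W)"
    by (rule perfect_matching_Un[OF 1 2]) (use SW in auto)
  moreover have "(S - ?Q) \<union> (W \<union> ?Q) = S \<union> W" using QS by auto
  ultimately show ?thesis by metis
qed

end

end

section \<open>The degree-sum theorem\<close>

lemma perfect_matching_of_degree_sums:
  assumes graph: "three_graph V E" and n: "card V = 3 * k" "100000000 \<le> card V"
    and non_iso: "\<And>v. v \<in> V \<Longrightarrow> \<not> isolated_vertex E v"
    and deg: "\<And>u v. adjacent E u v \<Longrightarrow> 2 * (card V)\<^sup>2 + 6 < 3 * (hdeg E u + hdeg E v) + 8 * card V"
  shows "\<exists>M. perfect_matching V E M"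
proof (rule ccontr)
  assume none: "\<not> ?thesis"
  let ?n = "card V"
  \<comment> \<open>The threshold is half of the degree-sum bound, so two vertices of
    \<open>S\<close> exceed the bound together and two vertices of \<open>W\<close> do not.\<close>
  define S where "S = {v \<in> V. ?n\<^sup>2 + 3 < 3 * hdeg E v + 4 * ?n}"
  define W where "W = {v \<in> V. \<not> ?n\<^sup>2 + 3 < 3 * hdeg E v + 4 * ?n}"
  define N where "N w = {u. adjacent E w u}" for w
  have edge: "e \<subseteq> V" "card e = 3" if "e \<in> E" for e using graph that by (auto simp: three_graph_def)
  have finV: "finite V" using graph by (simp add: three_graph_def)
  have adjV: "u \<in> V" "v \<in> V" if "adjacent E u v" for u v using that edge by (auto simp: adjacent_def)
  have VSW: "V = S \<union> W" "S \<inter> W = {}" by (auto simp: S_def W_def)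
  have NS: "N w \<subseteq> S" if "w \<in> W" for w
  proof
    fix u assume "u \<in> N w"
    hence a: "adjacent E w u" by (simp add: N_def)
    show "u \<in> S" using deg[OF a] adjV[OF a] that by (auto simp: S_def W_def)
  qed
  have finSW: "finite S" "finite W" using finV by (auto simp: S_def W_def)
  interpret C: star_closure S W N
    by (unfold_locales; fact finSW VSW(2) NS)
  let ?F = "closure_edges S W N"
  have EF: "E \<subseteq> ?F"
  proof
    fix e assume e: "e \<in> E"
    show "e \<in> ?F"
    proof (cases "e \<subseteq> S")
      case True
      thus ?thesis using edge[OF e] by (simp add: closure_edges_def)
    next
      case False
      then obtain w where w: "w \<in> e" "w \<in> W" using edge(1)[OF e] VSW by auto
      have "e - {w} \<subseteq> N w" using e w by (auto simp: N_def adjacent_def)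
      moreover have "card (e - {w}) = 2" "e = insert w (e - {w})" using edge(2)[OF e] w by auto
      ultimately show ?thesis using w(2) unfolding closure_edges_def by blast
    qed
  qed
  have FV: "t \<subseteq> V \<and> card t = 3" if "t \<in> ?F" for t
    using that unfolding closure_edges_def
  proof (elim UnE CollectE exE conjE)
    fix w P assume t: "t = insert w P" "w \<in> W" "P \<subseteq> N w" "card P = 2"
    have "w \<notin> P" "finite P" using t NS VSW(2) card.infinite[of P] by force+
    thus ?thesis using t NS VSW(1) by auto
  qed (use VSW in auto)
  have mono: "hdeg E v \<le> hdeg E' v" if "E \<subseteq> E'" "E' \<subseteq> ?F" for E' v
    unfolding hdeg_def using that finite_subset[OF that(2) C.closure_edge_finite] by (intro card_mono) auto
  \<comment> \<open>Two vertices of \<open>S\<close> satisfy the condition whether or not they are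
    adjacent in \<open>E\<close>, and additional edges only raise degrees.\<close>
  have deg': "2 * ?n\<^sup>2 + 6 < 3 * (hdeg E' u + hdeg E' v) + 8 * ?n"
    if E': "E \<subseteq> E'" "E' \<subseteq> ?F" and uv: "(u \<in> S \<and> v \<in> S) \<or> adjacent E u v" for E' u v
  proof -
    have "2 * ?n\<^sup>2 + 6 < 3 * (hdeg E u + hdeg E v) + 8 * ?n"
      using uv deg by (auto simp: S_def)
    thus ?thesis using mono[OF E', of u] mono[OF E', of v] unfolding distrib_left by linarith
  qed
  have "\<exists>M. perfect_matching (S \<union> W) ?F M"
  proof (rule C.closure_perfect_matching)
    show "card S + card W = 3 * k"
      using card_Un_disjoint[of S W] VSW C.fin n(1) by simp
    show "N w \<noteq> {}" if "w \<in> W" for w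
    proof -
      have "hdeg E w \<noteq> 0" using non_iso that by (auto simp: isolated_vertex_def W_def)
      hence "{e \<in> E. w \<in> e} \<noteq> {}" unfolding hdeg_def by (metis card.empty)
      then obtain e where e: "e \<in> E" "w \<in> e" by auto
      obtain v where "v \<in> e" "v \<noteq> w" using card_3_avoid edge(2)[OF e(1)] by metis
      thus ?thesis using e by (auto simp: N_def adjacent_def)
    qed
    show "6 * k\<^sup>2 + 2 < hdeg ?F w + hdeg ?F u + 8 * k" if "w \<in> W" "u \<in> N w" for w u
      using deg'[OF EF order_refl, of w u] that(2) n(1) by (simp add: N_def power_mult_distrib)
  qed
  hence pmF: "\<exists>M. perfect_matching V ?F M" using VSW by simp
  \<comment> \<open>In a maximal member of \<open>X\<close>, any missing closure edge
    \<open>t\<close> completes a perfect matching; removing \<open>t\<close> from it leaves a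
    matching of \<open>V - t\<close>.\<close>
  define X where "X = {E'. E \<subseteq> E' \<and> E' \<subseteq> ?F \<and> (\<nexists>M. perfect_matching V E' M)}"
  have "finite X" by (rule finite_subset[of _ "Pow ?F"]) (use C.closure_edge_finite in \<open>auto simp: X_def\<close>)
  moreover have "E \<in> X" using EF none by (simp add: X_def)
  ultimately have "\<exists>E'\<in>X. E \<subseteq> E' \<and> (\<forall>E''\<in>X. E' \<subseteq> E'' \<longrightarrow> E' = E'')"
    by (rule finite_has_maximal2)
  then obtain E' where E': "E' \<in> X" "\<forall>E''\<in>X. E' \<subseteq> E'' \<longrightarrow> E' = E''"
    by (elim bexE conjE)
  have EE': "E \<subseteq> E'" "E' \<subseteq> ?F" and noE': "\<nexists>M. perfect_matching V E' M" using E'(1) by (auto simp: X_def)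
  have "E' \<noteq> ?F" using noE' pmF by auto
  then obtain t where t: "t \<in> ?F" "t \<notin> E'" using EE' by auto
  have "insert t E' \<notin> X"
  proof
    assume "insert t E' \<in> X"
    hence "E' = insert t E'" using bspec[OF E'(2)] by (meson subset_insertI)
    thus False using t(2) by auto
  qed
  moreover have "E \<subseteq> insert t E'" "insert t E' \<subseteq> ?F" using EE' t(1) by auto
  ultimately obtain P where P: "perfect_matching V (insert t E') P" by (auto simp: X_def)
  have "t \<in> P"
  proof (rule ccontr)
    assume "t \<notin> P"
    hence "perfect_matching V E' P" using P by (auto simp: perfect_matching_def)
    thus False using noE' by blast
  qed
  have "perfect_matching (V - \<Union>{t}) (insert t E') (P - {t})"
    by (rule perfect_matching_Diff[OF P]) (use \<open>t \<in> P\<close> in simp)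
  hence "perfect_matching (V - t) E' (P - {t})" by (auto simp: perfect_matching_def)
  hence L: "leftover V E' t (P - {t})" using FV[OF t(1)] by (simp add: leftover_def)
  have "three_graph V E'" using finV FV EE'(2) unfolding three_graph_def by blast
  moreover have "\<not> perfect_matching V E' M" for M using noE' by blast
  ultimately interpret H: no_matching_graph V E' by unfold_locales
  have degt: "?n\<^sup>2 \<le> 3 * hdeg E' x + 40 * ?n" if x: "x \<in> t" for x
  proof (cases "x \<in> S")
    case True
    thus ?thesis using mono[OF EE', of x] by (auto simp: S_def)
  next
    case False
    hence "\<not> t \<subseteq> S" using x by auto
    then obtain w Q where Q: "t = insert w Q" "w \<in> W" "Q \<subseteq> N w" "card Q = 2"
      using t(1) by (auto simp: closure_edges_def)
    have xw: "x = w" using False x Q NS by auto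
    obtain u v where uv: "Q = {u,v}" "u \<noteq> v" using Q(4) by (auto simp: card_2_iff)
    have adj: "adjacent E w u" "adjacent E w v" using Q(3) uv by (auto simp: N_def)
    hence "w \<noteq> u" "w \<noteq> v" by (auto simp: adjacent_def)
    hence "2 * hdeg E' w + 2 * hdeg E' u + 2 * hdeg E' v \<le> 2 * ?n\<^sup>2 + 9 * ?n + 9"
      using H.degree_sum_bound[OF L] Q(1) uv by simp
    \<comment> \<open>Adding the conditions for \<open>w,u\<close> and \<open>w,v\<close> and
      subtracting \<open>degree_sum_bound\<close> leaves \<open>3 * hdeg E' w\<close> at least
      \<open>n^2 - 30 * n\<close>.\<close>
    moreover have "2 * ?n\<^sup>2 + 6 < 3 * hdeg E' w + 3 * hdeg E' u + 8 * ?n"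
      "2 * ?n\<^sup>2 + 6 < 3 * hdeg E' w + 3 * hdeg E' v + 8 * ?n"
      using deg'[OF EE', of w u] deg'[OF EE', of w v] adj by auto
    ultimately show ?thesis using n(2) unfolding xw by linarith
  qed
  \<comment> \<open>Saturation creates new adjacencies only inside \<open>S\<close>.\<close>
  have adjF: "(u \<in> S \<and> v \<in> S) \<or> adjacent E u v" if a: "adjacent E' u v" for u v
  proof -
    obtain e where e: "e \<in> ?F" "u \<in> e" "v \<in> e" "u \<noteq> v" using a EE'(2) by (auto simp: adjacent_def)
    from e(1) consider "e \<subseteq> S" | w Q where "e = insert w Q" "w \<in> W" "Q \<subseteq> N w"
      by (auto simp: closure_edges_def)
    thus ?thesis
    proof cases
      case 2
      have "adjacent E w y" if "y \<in> Q" for y using 2(3) that by (auto simp: N_def)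
      moreover have "adjacent E y w" if "adjacent E w y" for y using that by (auto simp: adjacent_def)
      ultimately show ?thesis using e 2 NS[OF 2(2)] by auto
    qed (use e in auto)
  qed
  interpret near_matching V E' t "P - {t}"
    by (unfold_locales; fact L n(2) degt deg'[OF EE' adjF])
  show False by (rule contradiction)
qed

theorem theorem1p1:
  shows "\<exists>n0::nat. \<forall>n\<ge>n0. 3 dvd n \<longrightarrow>
    (\<forall>(V :: 'a set) (E :: 'a set set).
      three_graph V E \<longrightarrow> card V = n \<longrightarrow>
      (\<forall>v\<in>V. \<not> isolated_vertex E v) \<longrightarrow>
      real (sigma2' V E) > 2 / 3 * (real n)\<^sup>2 - 8 / 3 * real n + 2 \<longrightarrow>
      (\<exists>M. perfect_matching V E M))"
proof (intro exI[of _ 100000000] allI impI)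
  fix n :: nat and V :: "'a set" and E :: "'a set set"
  assume n: "100000000 \<le> n" "3 dvd n" and graph: "three_graph V E" and cV: "card V = n"
    and non_iso: "\<forall>v\<in>V. \<not> isolated_vertex E v"
    and sigma: "2 / 3 * (real n)\<^sup>2 - 8 / 3 * real n + 2 < real (sigma2' V E)"
  obtain k where k: "n = 3 * k" using n(2) by (rule dvdE)
  let ?D = "{hdeg E u + hdeg E v | u v. u \<in> V \<and> v \<in> V \<and> adjacent E u v}"
  have "finite V" using graph by (simp add: three_graph_def)
  have "finite ?D"
    by (rule finite_subset[of _ "(\<lambda>(u,v). hdeg E u + hdeg E v) ` (V \<times> V)"])
      (use \<open>finite V\<close> in auto)
  have "2 * n\<^sup>2 + 6 < 3 * (hdeg E u + hdeg E v) + 8 * n" if a: "adjacent E u v" for u v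
  proof -
    have "u \<in> V" "v \<in> V" using a graph by (auto simp: adjacent_def three_graph_def)
    \<comment> \<open>The given adjacent pair makes \<open>?D\<close> nonempty, so the unspecified
      case of \<open>Min\<close> does not arise.\<close>
    hence "sigma2' V E \<le> hdeg E u + hdeg E v"
      unfolding sigma2'_def using \<open>finite ?D\<close> a by (intro Min_le) auto
    hence "real (sigma2' V E) \<le> real (hdeg E u + hdeg E v)" by (rule of_nat_mono)
    hence "2 * (real n)\<^sup>2 + 6 < 3 * real (hdeg E u + hdeg E v) + 8 * real n" using sigma by argo
    hence "real (2 * n\<^sup>2 + 6) < real (3 * (hdeg E u + hdeg E v) + 8 * n)" by simp
    thus ?thesis unfolding of_nat_less_iff .
  qed
  thus "\<exists>M. perfect_matching V E M"
    using perfect_matching_of_degree_sums[of V E k] graph non_iso n k cV by auto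
qed

end
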